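(* Let $N>1$ and consider a system of $N$ linear hyperbolic equations with random initial data $$\partial_t\vec z(t,x;\omega)+D(x)\,\partial_x\vec z=0,\qquad \vec z(0,x;\omega)=\vec z_{(0,x)}(\omega),$$ where $D(x)$ can be diagonalized by an $x$-independent matrix $P$; equivalently, a system of the form $$\partial_t u^i(t,x;\omega)+c_i(x)\,\partial_x u^i=0,\qquad u^i(0,x;\omega)=u^i_{(0,x)}(\omega),\qquad 1\le i\le N.$$ Define the $N$-point pointwise statistics as the Young measure satisfying, for every measurable $A\subseteq\mathbb{R}^N$, $$\phi_{t,x_1,\ldots,x_N}(A)=\mu\left(\left\{\omega\in\Omega:\ \left(u^1(t,x_1;\omega),\ldots,u^N(t,x_N;\omega)\right)^\top\in A\right\}\right).$$ Then its density $f(t,x_1,\ldots,x_N,U_1,\ldots,U_N)$ satisfies $$\partial_t f(t,x_1,\ldots,x_N,U_1,\ldots,U_N)+\sum_{i=1}^N c_i(x_i)\,\partial_{x_i}f=0.$$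
   Context: $\Omega\subseteq\mathbb{R}^d$ is equipped with a Borel probability measure $\mu$; for each $x\in\mathbb{R}$ the initial data $\vec z_{(0,x)}:\Omega\to\mathbb{R}^N$ are measurable. The map $x\mapsto D(x)$ from $\mathbb{R}$ to real $N\times N$ matrices is smooth, with each $D(x)$ real diagonalizable. Diagonalizable by an $x$-independent matrix means that there is an invertible $P$ with $PD(x)P^{-1}=\mathrm{diag}(c_1(x),\ldots,c_N(x))$ for all $x\in\mathbb{R}$; then $(u^1,\ldots,u^N)^\top=P\vec z$. A Young measure is a measure-valued function (here of $(t,x_1,\ldots,x_N)$, with values in probability measures on $\mathbb{R}^N$). *)

theory Defs
  imports "HOL-Probability.Probability"
begin

text \<open>Intended for open \<open>S\<close>: derivatives are taken in the full space, and continuity of the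
  derivative is with respect to the operator norm.\<close>

definition C1_on :: "'a::real_normed_vector set \<Rightarrow> ('a \<Rightarrow> 'b::real_normed_vector) \<Rightarrow> bool" where
  "C1_on S g \<longleftrightarrow> (\<exists>g' :: 'a \<Rightarrow> 'a \<Rightarrow>\<^sub>L 'b.
     continuous_on S g' \<and> (\<forall>z\<in>S. (g has_derivative blinfun_apply (g' z)) (at z)))"

definition smooth_curve :: "(real \<Rightarrow> 'b::real_normed_vector) \<Rightarrow> bool" where
  "smooth_curve g \<longleftrightarrow> (\<exists>G :: nat \<Rightarrow> real \<Rightarrow> 'b.
     G 0 = g \<and> (\<forall>k x. (G k has_vector_derivative G (Suc k) x) (at x)))"

definition partial_deriv :: "'n \<Rightarrow> (real ^ 'n \<Rightarrow> real) \<Rightarrow> real ^ 'n \<Rightarrow> real" where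
  "partial_deriv i g x = deriv (\<lambda>s. g (x + s *\<^sub>R axis i 1)) 0"

definition diag_matrix :: "real ^ 'n \<Rightarrow> real ^ 'n ^ 'n" where
  "diag_matrix v = (\<chi> i j. if i = j then v $ i else 0)"

definition real_diagonalizable :: "real ^ 'n ^ 'n \<Rightarrow> bool" where
  "real_diagonalizable A \<longleftrightarrow>
     (\<exists>(Q :: real ^ 'n ^ 'n) v. invertible Q \<and> Q ** A ** matrix_inv Q = diag_matrix v)"


text \<open>Systems are solved in the classical sense, for times \<open>t \<ge> 0\<close>: a solution is continuous up to
  \<open>t = 0\<close>, where it takes the initial values, and is continuously differentiable for \<open>t > 0\<close>,
  where the equation holds pointwise.\<close>

definition regular_field :: "(real \<Rightarrow> real \<Rightarrow> real ^ 'n) \<Rightarrow> bool" where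
  "regular_field w \<longleftrightarrow>
     continuous_on ({0..} \<times> UNIV) (\<lambda>(t, x). w t x) \<and>
     C1_on ({0<..} \<times> UNIV) (\<lambda>(t, x). w t x)"

definition solves_system ::
  "(real \<Rightarrow> real ^ 'n ^ 'n) \<Rightarrow> (real \<Rightarrow> real ^ 'n) \<Rightarrow> (real \<Rightarrow> real \<Rightarrow> real ^ 'n) \<Rightarrow> bool" where
  "solves_system D w0 w \<longleftrightarrow>
     regular_field w \<and>
     (\<forall>t>0. \<forall>x. vector_derivative (\<lambda>s. w s x) (at t)
                + D x *v vector_derivative (\<lambda>y. w t y) (at x) = 0) \<and>
     (\<forall>x. w 0 x = w0 x)"

definition solves_decoupled ::
  "(real \<Rightarrow> real ^ 'n) \<Rightarrow> (real \<Rightarrow> real ^ 'n) \<Rightarrow> (real \<Rightarrow> real \<Rightarrow> real ^ 'n) \<Rightarrow> bool" where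
  "solves_decoupled c v0 v \<longleftrightarrow>
     regular_field v \<and>
     (\<forall>i. \<forall>t>0. \<forall>x. deriv (\<lambda>s. v s x $ i) t + c x $ i * deriv (\<lambda>y. v t y $ i) x = 0) \<and>
     (\<forall>i x. v 0 x $ i = v0 x $ i)"


text \<open>The \<open>i\<close>-th component is observed at its own point \<open>x $ i\<close>. Measurability of the events on the
  right need not be required separately: \<open>measure\<close> is \<open>0\<close> on non-measurable sets, so if the event
  for \<open>A\<close> were not measurable, \<open>A\<close> and its complement would both have \<open>\<phi>\<close>-measure \<open>0\<close>.\<close>

definition pointwise_statistics ::
  "'w measure \<Rightarrow> (real \<Rightarrow> real \<Rightarrow> 'w \<Rightarrow> real ^ 'n)
    \<Rightarrow> (real \<Rightarrow> real ^ 'n \<Rightarrow> (real ^ 'n) measure) \<Rightarrow> bool" where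
  "pointwise_statistics \<mu> u \<phi> \<longleftrightarrow>
     (\<forall>t\<ge>0. \<forall>x. prob_space (\<phi> t x) \<and> sets (\<phi> t x) = sets borel \<and>
        (\<forall>A\<in>sets borel.
           measure (\<phi> t x) A = measure \<mu> {\<omega> \<in> space \<mu>. (\<chi> i. u t (x $ i) \<omega> $ i) \<in> A}))"

definition is_density ::
  "(real \<Rightarrow> real ^ 'n \<Rightarrow> (real ^ 'n) measure) \<Rightarrow> (real \<Rightarrow> real ^ 'n \<Rightarrow> real ^ 'n \<Rightarrow> real) \<Rightarrow> bool" where
  "is_density \<phi> f \<longleftrightarrow>
     (\<lambda>(t, x, U). f t x U) \<in> borel_measurable (restrict_space borel ({0..} \<times> UNIV)) \<and>
     (\<forall>t\<ge>0. \<forall>x U. 0 \<le> f t x U) \<and>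
     (\<forall>t\<ge>0. \<forall>x. \<phi> t x = density lborel (\<lambda>U. ennreal (f t x U)))"


definition transport_operator ::
  "(real \<Rightarrow> real ^ 'n) \<Rightarrow> (real \<Rightarrow> real ^ 'n \<Rightarrow> real ^ 'n \<Rightarrow> real)
    \<Rightarrow> real \<Rightarrow> real ^ 'n \<Rightarrow> real ^ 'n \<Rightarrow> real" where
  "transport_operator c f t x U =
     deriv (\<lambda>s. f s x U) t
     + (\<Sum>i\<in>UNIV. c (x $ i) $ i * partial_deriv i (\<lambda>y. f t y U) x)"

text \<open>Continuously differentiable functions of \<open>(t, x, U)\<close> with compact support in \<open>t > 0\<close>. This
  contains the smooth compactly supported functions.\<close>

definition test_function ::
  "(real \<Rightarrow> real ^ 'n \<Rightarrow> real ^ 'n \<Rightarrow> real) \<Rightarrow> bool" where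
  "test_function \<psi> \<longleftrightarrow>
     C1_on UNIV (\<lambda>(t, x, U). \<psi> t x U) \<and>
     (\<exists>K. compact K \<and> K \<subseteq> {0<..} \<times> UNIV \<and> (\<forall>t x U. (t, x, U) \<notin> K \<longrightarrow> \<psi> t x U = 0))"

text \<open>The equation \<open>transport_operator c f = 0\<close> in the sense of distributions. As the equation is not
  in conservation form, the coefficient stays with the test function under the derivative:
  \<open>\<langle>c\<^sub>i \<partial>\<^sub>i f, \<psi>\<rangle> = - \<langle>f, \<partial>\<^sub>i (c\<^sub>i \<psi>)\<rangle>\<close>. Integrability is part of the claim.\<close>

definition transport_distributional ::
  "(real \<Rightarrow> real ^ 'n) \<Rightarrow> (real \<Rightarrow> real ^ 'n \<Rightarrow> real ^ 'n \<Rightarrow> real) \<Rightarrow> bool" where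
  "transport_distributional c f \<longleftrightarrow>
     (\<forall>\<psi>. test_function \<psi> \<longrightarrow>
        has_bochner_integral lborel
          (\<lambda>(t, x, U). f t x U *
             (deriv (\<lambda>s. \<psi> s x U) t
              + (\<Sum>i\<in>UNIV. partial_deriv i (\<lambda>y. c (y $ i) $ i * \<psi> t y U) x)))
          0)"

end

theory Submission
  imports Defs
begin

text \<open>Each component is constant along its own characteristic, and the points of observation may be
  moved along these characteristics simultaneously. Hence the law of the observations, and with
  it the density up to a null set of values \<open>U\<close>, is constant along the resulting curve with velocity
  \<open>c\<^sub>i(x\<^sub>i)\<close>; a countable sequence of times is enough to read off the derivative. For the equation
  in the sense of distributions, the pairing with a test function is the expectation of an integral
  over \<open>(t, x)\<close> which, for a single realisation, is that of a compactly supported divergence.\<close>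

section \<open>Decoupling\<close>

text \<open>The coefficients may grow, so characteristics exist only locally in general and there
  need not be a global flow along which to push densities. Two facts compensate. A characteristic
  depends on \<open>c\<close> alone, so one neighbourhood of \<open>t\<close> serves every
  realisation at once; and a local curve suffices to differentiate at a point. The weak equation is
  not deduced from the pointwise one, because \<open>f\<close> is merely measurable: a density is
  fixed only up to a null set of \<open>U\<close> for each \<open>(t, x)\<close> and need not be
  differentiable anywhere. All derivatives there fall on the coefficients, the test function and the
  classical solutions, and \<open>f\<close> enters only by turning integrals over \<open>U\<close>
  into expectations.\<close>

lemma regular_field_matrix:
  fixes A :: "real ^ 'n ^ 'm"
  assumes "regular_field w"
  shows "regular_field (\<lambda>t x. A *v w t x)"
proof -
  have blA: "bounded_linear ((*v) A)"
    by (rule matrix_vector_mul_bounded_linear)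
  define L where "L = Blinfun ((*v) A)"
  have L: "blinfun_apply L = (*v) A"
    unfolding L_def by (rule bounded_linear_Blinfun_apply[OF blA])
  obtain w' where w': "continuous_on ({0<..} \<times> UNIV) w'"
    "\<And>p. p \<in> {0<..} \<times> UNIV \<Longrightarrow> ((\<lambda>(t, x). w t x) has_derivative blinfun_apply (w' p)) (at p)"
    using assms unfolding regular_field_def C1_on_def by blast
  have "C1_on ({0<..} \<times> UNIV) (\<lambda>(t, x). A *v w t x)"
    unfolding C1_on_def
  proof (intro exI conjI ballI)
    show "continuous_on ({0<..} \<times> UNIV) (\<lambda>p. L o\<^sub>L w' p)"
      by (intro bounded_bilinear.continuous_on[OF bounded_bilinear_blinfun_compose]
          continuous_on_const w'(1))
    show "((\<lambda>(t, x). A *v w t x) has_derivative blinfun_apply (L o\<^sub>L w' p)) (at p)"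
      if "p \<in> {0<..} \<times> UNIV" for p
      using bounded_linear.has_derivative[OF blA w'(2)[OF that]]
      by (simp add: L o_def case_prod_unfold blinfun_compose.rep_eq)
  qed
  moreover have "continuous_on ({0..} \<times> UNIV) (\<lambda>(t, x). A *v w t x)"
    using bounded_linear.continuous_on[OF blA, of "{0..} \<times> UNIV" "\<lambda>(t, x). w t x"] assms
    unfolding regular_field_def by (simp add: case_prod_unfold)
  ultimately show ?thesis
    unfolding regular_field_def by blast
qed

text \<open>Both partial derivatives are values of one total derivative, at \<open>(1, 0)\<close>
  and \<open>(0, 1)\<close>. Keeping the total derivative makes the chain rule along curves
  available.\<close>

lemma regular_field_derivative:
  fixes w :: "real \<Rightarrow> real \<Rightarrow> real ^ 'n"
  assumes "regular_field w"
  shows "\<exists>w'. continuous_on ({0<..} \<times> UNIV) w' \<and>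
    (\<forall>t>0. \<forall>x. ((\<lambda>(t, x). w t x) has_derivative blinfun_apply (w' (t, x))) (at (t, x)) \<and>
      ((\<lambda>s. w s x) has_vector_derivative blinfun_apply (w' (t, x)) (1, 0)) (at t) \<and>
      ((\<lambda>y. w t y) has_vector_derivative blinfun_apply (w' (t, x)) (0, 1)) (at x))"
proof -
  obtain w' where w': "continuous_on ({0<..} \<times> UNIV) w'"
    "\<And>p. p \<in> {0<..} \<times> UNIV \<Longrightarrow> ((\<lambda>(t, x). w t x) has_derivative blinfun_apply (w' p)) (at p)"
    using assms unfolding regular_field_def C1_on_def by blast
  have d: "((\<lambda>(t, x). w t x) has_derivative blinfun_apply (w' (t, x))) (at (t, x))" if "t > 0" for t x
    using w'(2)[of "(t, x)"] that by simp
  have 1: "((\<lambda>s. w s x) has_vector_derivative w' (t, x) (1, 0)) (at t)" if "t > 0" for t x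
  proof -
    have "((\<lambda>s. (s, x)) has_derivative (\<lambda>h. (h, 0))) (at t)"
      by (rule has_derivative_Pair[OF has_derivative_ident has_derivative_const])
    from has_derivative_compose[OF this d[OF that, of x]]
    have *: "((\<lambda>s. w s x) has_derivative (\<lambda>h. w' (t, x) (h, 0))) (at t)"
      by simp
    have "(\<lambda>h. w' (t, x) (h, 0)) = (\<lambda>h. h *\<^sub>R w' (t, x) (1, 0))"
      by (rule ext) (simp add: blinfun.scaleR_right[symmetric])
    from has_derivative_eq_rhs[OF * this] show ?thesis
      unfolding has_vector_derivative_def .
  qed
  have 2: "((\<lambda>y. w t y) has_vector_derivative w' (t, x) (0, 1)) (at x)" if "t > 0" for t x
  proof -
    have "((\<lambda>y. (t, y)) has_derivative (\<lambda>h. (0, h))) (at x)"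
      by (rule has_derivative_Pair[OF has_derivative_const has_derivative_ident])
    from has_derivative_compose[OF this d[OF that, of x]]
    have *: "((\<lambda>y. w t y) has_derivative (\<lambda>h. w' (t, x) (0, h))) (at x)"
      by simp
    have "(\<lambda>h. w' (t, x) (0, h)) = (\<lambda>h. h *\<^sub>R w' (t, x) (0, 1))"
      by (rule ext) (simp add: blinfun.scaleR_right[symmetric])
    from has_derivative_eq_rhs[OF * this] show ?thesis
      unfolding has_vector_derivative_def .
  qed
  show ?thesis
    using w'(1) d 1 2 by (intro exI[of _ w']) simp
qed

text \<open>Besides \<open>P\<close>, the matrix \<open>mat 1\<close> is used for \<open>A\<close>;
  this turns a vector derivative into ordinary derivatives of the components.\<close>

lemma deriv_matrix_vector_component:
  fixes A :: "real ^ 'n ^ 'm"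
  assumes "(g has_vector_derivative g') (at s)"
  shows "((\<lambda>s. (A *v g s) $ i) has_real_derivative (A *v g') $ i) (at s)"
proof -
  have "((\<lambda>s. (A *v g s) $ i) has_derivative (\<lambda>h. (A *v (h *\<^sub>R g')) $ i)) (at s)"
    using assms unfolding has_vector_derivative_def
    by (intro bounded_linear.has_derivative[OF bounded_linear_vec_nth]
        bounded_linear.has_derivative[OF matrix_vector_mul_bounded_linear])
  moreover have "(\<lambda>h. (A *v (h *\<^sub>R g')) $ i) = (*) ((A *v g') $ i)"
    by (rule ext) (simp add: matrix_vector_mult_scaleR)
  ultimately show ?thesis
    by (simp add: has_field_derivative_def)
qed

lemma diag_matrix_mult_vector: "(diag_matrix v *v y) $ i = v $ i * y $ i"
proof -
  have "(\<Sum>j\<in>UNIV. (if i = j then v $ i else 0) * y $ j) = (\<Sum>j\<in>UNIV. if j = i then v $ i * y $ i else 0)"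
    by (rule sum.cong) auto
  then show ?thesis
    by (simp add: diag_matrix_def matrix_vector_mult_def)
qed

lemma matrix_inv_cancel:
  fixes P :: "real ^ 'n ^ 'n"
  assumes "invertible P"
  shows "matrix_inv P *v (P *v y) = y" "P *v (matrix_inv P *v y) = y"
proof -
  have "P ** matrix_inv P = mat 1 \<and> matrix_inv P ** P = mat 1"
    unfolding matrix_inv_def by (rule someI_ex[OF assms[unfolded invertible_def]])
  then show "matrix_inv P *v (P *v y) = y" "P *v (matrix_inv P *v y) = y"
    by (simp_all add: matrix_vector_mul_assoc)
qed

text \<open>Multiply the equation by \<open>P\<close> and use
  \<open>P ** D x = diag_matrix (c x) ** P\<close>; invertibility of \<open>P\<close> leads back.
  The equations are compared only for regular fields, since at points without a derivative
  \<open>deriv\<close> and \<open>vector_derivative\<close> have unspecified values.\<close>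

lemma solves_system_iff_decoupled:
  fixes P :: "real ^ 'n ^ 'n"
  assumes P: "invertible P"
    and PDP: "\<And>x. P ** D x ** matrix_inv P = diag_matrix (c x)"
  shows "solves_system D w0 w \<longleftrightarrow> solves_decoupled c (\<lambda>x. P *v w0 x) (\<lambda>t x. P *v w t x)"
proof -
  have regular: "regular_field w \<longleftrightarrow> regular_field (\<lambda>t x. P *v w t x)"
    using regular_field_matrix[of w P] regular_field_matrix[of "\<lambda>t x. P *v w t x" "matrix_inv P"]
    by (auto simp: matrix_inv_cancel[OF P])
  have inj: "P *v a = P *v b \<longleftrightarrow> a = b" for a b
    by (metis matrix_inv_cancel(1)[OF P])
  have diag: "(P *v (D x *v y)) $ i = c x $ i * (P *v y) $ i" for x y i
  proof -
    have "c x $ i * (P *v y) $ i = ((P ** D x ** matrix_inv P) *v (P *v y)) $ i"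
      by (simp add: PDP diag_matrix_mult_vector)
    also have "\<dots> = (P *v (D x *v y)) $ i"
      by (simp add: matrix_vector_mul_assoc[symmetric] matrix_inv_cancel[OF P])
    finally show ?thesis ..
  qed
  have eqn: "(\<forall>i :: 'n. deriv (\<lambda>s. (P *v w s x) $ i) t + c x $ i * deriv (\<lambda>y. (P *v w t y) $ i) x = 0)
     \<longleftrightarrow> vector_derivative (\<lambda>s. w s x) (at t) + D x *v vector_derivative (\<lambda>y. w t y) (at x) = 0"
    if reg: "regular_field w" and t: "t > 0" for t x
  proof -
    obtain a b where w': "((\<lambda>s. w s x) has_vector_derivative a) (at t)"
        "((\<lambda>y. w t y) has_vector_derivative b) (at x)"
      using regular_field_derivative[OF reg] t by blast
    have "deriv (\<lambda>s. (P *v w s x) $ i) t + c x $ i * deriv (\<lambda>y. (P *v w t y) $ i) x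
       = (P *v (a + D x *v b)) $ i" for i
      using w'[THEN deriv_matrix_vector_component[of _ _ _ P i], THEN DERIV_imp_deriv]
      by (simp only: diag matrix_vector_right_distrib vector_add_component)
    then have "(\<forall>i. deriv (\<lambda>s. (P *v w s x) $ i) t + c x $ i * deriv (\<lambda>y. (P *v w t y) $ i) x = 0)
       \<longleftrightarrow> P *v (a + D x *v b) = 0"
      by (simp only: vec_eq_iff zero_index)
    also have "\<dots> \<longleftrightarrow> a + D x *v b = 0"
      using inj[of "a + D x *v b" 0] by (simp only: matrix_vector_mult_0_right)
    finally show ?thesis
      by (simp only: w'[THEN vector_derivative_at])
  qed
  have init: "(\<forall>i x. (P *v w 0 x) $ i = (P *v w0 x) $ i) \<longleftrightarrow> (\<forall>x. w 0 x = w0 x)"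
    using inj by (metis vec_eq_iff)
  have "solves_decoupled c (\<lambda>x. P *v w0 x) (\<lambda>t x. P *v w t x) \<longleftrightarrow>
      regular_field w \<and>
      (\<forall>t>0. \<forall>x. \<forall>i. deriv (\<lambda>s. (P *v w s x) $ i) t + c x $ i * deriv (\<lambda>y. (P *v w t y) $ i) x = 0) \<and>
      (\<forall>x. w 0 x = w0 x)"
    unfolding solves_decoupled_def regular[symmetric] init by blast
  then show ?thesis
    unfolding solves_system_def using eqn by blast
qed

section \<open>Characteristics\<close>

text \<open>The form suited to the chain rule: component \<open>i\<close> has zero derivative in the
  direction \<open>(1, c x $ i)\<close> of its characteristic.\<close>

lemma solves_decoupled_derivative:
  fixes v :: "real \<Rightarrow> real \<Rightarrow> real ^ 'n"
  assumes "solves_decoupled c v0 v"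
  shows "\<exists>v'. continuous_on ({0<..} \<times> UNIV) v' \<and>
    (\<forall>t>0. \<forall>x. ((\<lambda>(t, x). v t x) has_derivative blinfun_apply (v' (t, x))) (at (t, x)) \<and>
      (\<forall>i. blinfun_apply (v' (t, x)) (1, 0) $ i + c x $ i * blinfun_apply (v' (t, x)) (0, 1) $ i = 0))"
proof -
  have "regular_field v"
    using assms unfolding solves_decoupled_def by blast
  from regular_field_derivative[OF this] obtain v' where v': "continuous_on ({0<..} \<times> UNIV) v'"
    "\<And>t x. t > 0 \<Longrightarrow> ((\<lambda>(t, x). v t x) has_derivative blinfun_apply (v' (t, x))) (at (t, x))"
    "\<And>t x. t > 0 \<Longrightarrow> ((\<lambda>s. v s x) has_vector_derivative blinfun_apply (v' (t, x)) (1, 0)) (at t)"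
    "\<And>t x. t > 0 \<Longrightarrow> ((\<lambda>y. v t y) has_vector_derivative blinfun_apply (v' (t, x)) (0, 1)) (at x)"
    by blast
  have "blinfun_apply (v' (t, x)) (1, 0) $ i + c x $ i * blinfun_apply (v' (t, x)) (0, 1) $ i = 0"
    if "t > 0" for t x i
  proof -
    have "deriv (\<lambda>s. v s x $ i) t = blinfun_apply (v' (t, x)) (1, 0) $ i"
      using deriv_matrix_vector_component[OF v'(3)[OF that], where A = "mat 1" and i = i]
      by (intro DERIV_imp_deriv) (simp only: matrix_vector_mul_lid)
    moreover have "deriv (\<lambda>y. v t y $ i) x = blinfun_apply (v' (t, x)) (0, 1) $ i"
      using deriv_matrix_vector_component[OF v'(4)[OF that], where A = "mat 1" and i = i]
      by (intro DERIV_imp_deriv) (simp only: matrix_vector_mul_lid)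
    ultimately show ?thesis
      using assms that unfolding solves_decoupled_def by metis
  qed
  with v'(1,2) show ?thesis
    by blast
qed

text \<open>Started at a zero of \<open>a\<close> the solution is constant; otherwise it is the inverse of a primitive
  of \<open>1 / a\<close>, so that continuity of \<open>a\<close> suffices.\<close>

lemma autonomous_ode_local_solution:
  fixes a :: "real \<Rightarrow> real"
  assumes a: "continuous_on UNIV a"
  shows "\<exists>X. X t0 = x0 \<and> (\<forall>\<^sub>F s in nhds t0. (X has_real_derivative a (X s)) (at s))"
proof (cases "a x0 = 0")
  case True
  then show ?thesis
    by (intro exI[of _ "\<lambda>_. x0"]) auto
next
  case False
  have "isCont a x0"
    using a by (simp add: continuous_on_eq_continuous_at)
  then obtain e where e: "e > 0" "\<And>y. dist y x0 < e \<Longrightarrow> a y \<noteq> 0"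
    using continuous_at_avoid[of x0 a 0] False by (auto simp: dist_commute)
  \<comment> \<open>Halving the radius makes even the closed interval around \<open>x0\<close> free
    of zeros of \<open>a\<close>.\<close>
  define r where "r = e / 2"
  have r: "r > 0" "\<And>y. y \<in> {x0 - r..x0 + r} \<Longrightarrow> a y \<noteq> 0"
    using e by (auto simp: r_def dist_real_def intro!: e(2))
  \<comment> \<open>Integrating from the left end of the interval covers points on both sides of
    \<open>x0\<close>; \<open>F\<close> then shifts the primitive so that
    \<open>F x0 = t0\<close>.\<close>
  define G where "G y = integral {x0 - r..y} (\<lambda>y. 1 / a y)" for y
  define F where "F y = t0 + (G y - G x0)" for y
  define S where "S = {x0 - r<..<x0 + r}"
  have S: "open S" "x0 \<in> S"
    using r(1) by (auto simp: S_def)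
  have F: "(F has_real_derivative 1 / a y) (at y)" if "y \<in> S" for y
  proof -
    have "continuous_on {x0 - r..x0 + r} (\<lambda>y. 1 / a y)"
      using r(2) by (intro continuous_intros continuous_on_subset[OF a]) auto
    then have "(G has_real_derivative 1 / a y) (at y within {x0 - r..x0 + r})"
      unfolding G_def using that by (intro integral_has_real_derivative) (auto simp: S_def)
    then have "(G has_real_derivative 1 / a y) (at y)"
      using that at_within_Icc_at[of "x0 - r" y "x0 + r"] by (simp add: S_def)
    then show ?thesis
      unfolding F_def by (auto intro!: derivative_eq_intros)
  qed
  have contF: "continuous_on S F"
    using F by (intro continuous_at_imp_continuous_on ballI DERIV_isCont) blast
  \<comment> \<open>By the mean value theorem the difference is \<open>q - p\<close> times some
    \<open>1 / a z\<close>, which is nonzero whatever the sign of \<open>a\<close>.\<close>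
  have less: "F p \<noteq> F q" if "p \<in> S" "q \<in> S" "p < q" for p q
  proof -
    have "(F has_real_derivative 1 / a y) (at y)" if "p \<le> y" "y \<le> q" for y
      using that \<open>p \<in> S\<close> \<open>q \<in> S\<close> by (intro F) (simp add: S_def)
    from MVT2[OF \<open>p < q\<close> this]
    obtain z where z: "p < z" "z < q" "F q - F p = (q - p) * (1 / a z)"
      by blast
    then have "a z \<noteq> 0"
      using r(2) that by (simp add: S_def)
    with z show ?thesis
      by auto
  qed
  have inj: "inj_on F S"
    by (rule inj_onI) (metis less linorder_neqE_linordered_idom)
  define X where "X = inv_into S F"
  have XF: "X (F y) = y" if "y \<in> S" for y
    using inv_into_f_f[OF inj that] by (simp add: X_def)
  have "(X has_real_derivative a (X s)) (at s)" if "s \<in> F ` S" for s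
  proof -
    from that obtain y where y: "y \<in> S" "s = F y"
      by blast
    then have "a y \<noteq> 0"
      using r(2) by (simp add: S_def)
    then have "(X has_derivative (\<lambda>h. a y * h)) (at (F y))"
      using F[OF y(1)]
      by (intro has_derivative_inverse_strong[OF S(1) y(1) contF XF, where f' = "(*) (1 / a y)"])
        (auto simp: has_field_derivative_def fun_eq_iff)
    then show ?thesis
      by (simp add: y XF has_field_derivative_def)
  qed
  \<comment> \<open>Openness makes the differential equation hold for all times near
    \<open>t0\<close>, not just at \<open>t0\<close>.\<close>
  moreover have "open (F ` S)"
    by (rule invariance_of_domain[OF contF S(1) inj])
  moreover have "t0 \<in> F ` S"
    using S(2) by (intro image_eqI[of _ _ x0]) (auto simp: F_def)
  ultimately have "\<forall>\<^sub>F s in nhds t0. (X has_real_derivative a (X s)) (at s)"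
    unfolding eventually_nhds by blast
  moreover have "X t0 = x0"
    using XF[OF S(2)] by (simp add: F_def)
  ultimately show ?thesis
    by blast
qed

text \<open>The neighbourhood of times is chosen before the solution: \<open>X\<close> and the
  radius come from \<open>c\<close> alone. For random data, one curve therefore serves all
  realisations.\<close>

lemma decoupled_constant_on_characteristic:
  fixes c :: "real \<Rightarrow> real ^ 'n"
  assumes t0: "t0 > 0" and c: "continuous_on UNIV (\<lambda>x. c x $ i)"
  shows "\<exists>X. X t0 = x0 \<and> (X has_real_derivative c x0 $ i) (at t0) \<and>
    (\<forall>\<^sub>F s in nhds t0. \<forall>v0 v. solves_decoupled c v0 v \<longrightarrow> v s (X s) $ i = v t0 x0 $ i)"
proof -
  obtain X where X: "X t0 = x0" "\<forall>\<^sub>F s in nhds t0. (X has_real_derivative c (X s) $ i) (at s)"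
    using autonomous_ode_local_solution[OF c] by blast
  moreover have "\<forall>\<^sub>F s in nhds t0. s > 0"
    using eventually_nhds_in_open[of "{0<..}" t0] t0 by simp
  ultimately have "\<forall>\<^sub>F s in nhds t0. (X has_real_derivative c (X s) $ i) (at s) \<and> s > 0"
    by (simp add: eventually_conj_iff)
  then obtain d where d: "d > 0"
    "\<And>s. s \<in> ball t0 d \<Longrightarrow> (X has_real_derivative c (X s) $ i) (at s) \<and> s > 0"
    unfolding eventually_nhds_metric by (auto simp: dist_commute)
  have "v s (X s) $ i = v t0 x0 $ i" if v: "solves_decoupled c v0 v" and s: "s \<in> ball t0 d" for v0 v s
  proof -
    obtain v' where v':
      "\<And>t x. t > 0 \<Longrightarrow> ((\<lambda>(t, x). v t x) has_derivative blinfun_apply (v' (t, x))) (at (t, x))"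
      "\<And>t x i. t > 0 \<Longrightarrow> blinfun_apply (v' (t, x)) (1, 0) $ i + c x $ i * blinfun_apply (v' (t, x)) (0, 1) $ i = 0"
      using solves_decoupled_derivative[OF v] by blast
    have deriv0: "((\<lambda>s. v s (X s) $ i) has_real_derivative 0) (at s within ball t0 d)" if "s \<in> ball t0 d" for s
    proof -
      have "((\<lambda>s. (s, X s)) has_derivative (\<lambda>h. (h, c (X s) $ i * h))) (at s)"
        using d(2)[OF that] unfolding has_field_derivative_def
        by (intro has_derivative_Pair has_derivative_ident) auto
      from has_derivative_compose[OF this v'(1)] d(2)[OF that]
      have "((\<lambda>s. v s (X s)) has_derivative (\<lambda>h. blinfun_apply (v' (s, X s)) (h, c (X s) $ i * h))) (at s)"
        by simp
      from bounded_linear.has_derivative[OF bounded_linear_vec_nth this]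
      have *: "((\<lambda>s. v s (X s) $ i) has_derivative
          (\<lambda>h. blinfun_apply (v' (s, X s)) (h, c (X s) $ i * h) $ i)) (at s)" .
      \<comment> \<open>The increment along the curve is proportional to
        \<open>(1, c (X s) $ i)\<close>, the direction in which the equation makes component
        \<open>i\<close> stationary.\<close>
      have "blinfun_apply (v' (s, X s)) (h, c (X s) $ i * h) $ i = 0" for h
      proof -
        have "(h, c (X s) $ i * h) = h *\<^sub>R (1, 0) + (c (X s) $ i * h) *\<^sub>R (0, 1)"
          by simp
        then have "blinfun_apply (v' (s, X s)) (h, c (X s) $ i * h) $ i
           = h * (blinfun_apply (v' (s, X s)) (1, 0) $ i + c (X s) $ i * blinfun_apply (v' (s, X s)) (0, 1) $ i)"
          by (simp only: blinfun.add_right blinfun.scaleR_right vector_add_component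
              vector_scaleR_component real_scaleR_def) (simp add: algebra_simps)
        then show ?thesis
          using v'(2) d(2)[OF that] by simp
      qed
      with * show ?thesis
        by (auto simp: has_field_derivative_def lambda_zero intro: has_derivative_at_withinI)
    qed
    have "\<exists>k. \<forall>s\<in>ball t0 d. v s (X s) $ i = k"
      by (rule has_field_derivative_zero_constant[OF convex_ball deriv0])
    then obtain k where k: "\<forall>s\<in>ball t0 d. v s (X s) $ i = k" ..
    have "v s (X s) $ i = v t0 (X t0) $ i"
      using k s d(1) by simp
    then show ?thesis
      by (simp only: X(1))
  qed
  then have "\<forall>\<^sub>F s in nhds t0. \<forall>v0 v. solves_decoupled c v0 v \<longrightarrow> v s (X s) $ i = v t0 x0 $ i"
    unfolding eventually_nhds_metric using d(1) by (auto simp: dist_commute)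
  moreover have "(X has_real_derivative c x0 $ i) (at t0)"
    using eventually_nhds_x_imp_x[OF X(2)] X(1) by simp
  ultimately show ?thesis
    using X(1) by blast
qed

section \<open>Transport of laws and densities along the characteristics\<close>

lemma has_derivative_vec_componentwise:
  fixes f :: "'a::real_normed_vector \<Rightarrow> real ^ 'n"
  assumes "\<And>i. ((\<lambda>x. f x $ i) has_derivative (\<lambda>h. f' h $ i)) (at a)"
  shows "(f has_derivative f') (at a)"
  by (subst has_derivative_componentwise_within)
    (use assms in \<open>auto simp: Basis_vec_def inner_axis\<close>)

lemma continuous_on_vec_componentwise:
  fixes f :: "'a::topological_space \<Rightarrow> real ^ 'n"
  assumes "\<And>i. continuous_on S (\<lambda>x. f x $ i)"
  shows "continuous_on S f"
  using continuous_on_vec_lambda[of S "\<lambda>i x. f x $ i"] assms by simp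

text \<open>The chain rule evaluates the derivative of \<open>g s (X s)\<close> at \<open>t\<close>
  as the transport expression, while its difference quotients along \<open>\<sigma>\<close> are
  eventually \<open>0\<close>. A sequence of times is enough because differentiability already
  guarantees that the limit exists.\<close>

lemma transport_zero_along_curve:
  fixes g :: "real \<Rightarrow> real ^ 'n \<Rightarrow> real"
  assumes g: "(\<lambda>(s, y). g s y) differentiable (at (t, x))"
    and X: "X t = x" "\<And>i. ((\<lambda>s. X s $ i) has_real_derivative b i) (at t)"
    and \<sigma>: "filterlim \<sigma> (at t) sequentially" "\<forall>\<^sub>F n in sequentially. g (\<sigma> n) (X (\<sigma> n)) = g t x"
  shows "deriv (\<lambda>s. g s x) t + (\<Sum>i\<in>UNIV. b i * partial_deriv i (\<lambda>y. g t y) x) = 0"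
proof -
  obtain L where L: "((\<lambda>(s, y). g s y) has_derivative L) (at (t, x))"
    using g unfolding differentiable_def by blast
  interpret L: bounded_linear L
    using L by (rule has_derivative_bounded_linear)
  define B where "B = (\<chi> i. b i)"
  have scale: "(\<lambda>h. L (h *\<^sub>R p)) = (*) (L p)" for p
    by (rule ext) (simp only: L.scaleR real_scaleR_def mult.commute)
  have "((\<lambda>s. g s x) has_derivative (\<lambda>h. L (h, 0))) (at t)"
    using has_derivative_compose[OF has_derivative_Pair[OF has_derivative_ident has_derivative_const] L]
    by simp
  then have dt: "deriv (\<lambda>s. g s x) t = L (1, 0)"
    using scale[of "(1, 0)"] by (intro DERIV_imp_deriv) (simp add: has_field_derivative_def)
  have dx: "partial_deriv i (\<lambda>y. g t y) x = L (0, axis i 1)" for i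
  proof -
    have "((\<lambda>s. x + s *\<^sub>R axis i 1) has_derivative (\<lambda>h. h *\<^sub>R axis i 1)) (at 0)"
      by (auto intro!: derivative_eq_intros)
    from has_derivative_compose[OF has_derivative_Pair[OF has_derivative_const this], of "\<lambda>(s, y). g s y" L t] L
    have "((\<lambda>s. g t (x + s *\<^sub>R axis i 1)) has_derivative (\<lambda>h. L (0, h *\<^sub>R axis i 1))) (at 0)"
      by simp
    then show ?thesis
      unfolding partial_deriv_def
      using scale[of "(0, axis i 1)"] by (intro DERIV_imp_deriv) (simp add: has_field_derivative_def)
  qed
  have "(X has_derivative (\<lambda>h. h *\<^sub>R B)) (at t)"
    using X(2) by (intro has_derivative_vec_componentwise)
      (simp add: B_def has_field_derivative_def mult_commute_abs)
  from has_derivative_compose[OF has_derivative_Pair[OF has_derivative_ident this], of "\<lambda>(s, y). g s y" L] L X(1)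
  have "((\<lambda>s. g s (X s)) has_derivative (\<lambda>h. L (h, h *\<^sub>R B))) (at t)"
    by simp
  then have "((\<lambda>s. g s (X s)) has_real_derivative L (1, B)) (at t)"
    using scale[of "(1, B)"] by (simp add: has_field_derivative_def)
  from filterlim_compose[OF has_field_derivativeD[OF this] \<sigma>(1)]
  have "(\<lambda>n. (g (\<sigma> n) (X (\<sigma> n)) - g t x) / (\<sigma> n - t)) \<longlonglongrightarrow> L (1, B)"
    by (simp only: X(1))
  moreover have "(\<lambda>n. (g (\<sigma> n) (X (\<sigma> n)) - g t x) / (\<sigma> n - t)) \<longlonglongrightarrow> 0"
    by (rule tendsto_eventually) (use \<sigma>(2) in eventually_elim, simp)
  ultimately have "L (1, B) = 0"
    by (rule LIMSEQ_unique)
  \<comment> \<open>Splitting the velocity into coordinate directions turns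
    \<open>L (1, B) = 0\<close> into the sum of partial derivatives.\<close>
  also have "(1, B) = (1, 0) + (\<Sum>i\<in>UNIV. b i *\<^sub>R (0, axis i 1))"
    using basis_expansion[of B]
    by (simp add: B_def sum_prod scalar_mult_eq_scaleR)
  finally show ?thesis
    by (simp only: L.add L.sum L.scaleR real_scaleR_def dt dx)
qed

text \<open>For each realisation the vector observed at \<open>X s\<close> at time \<open>s\<close>
  equals the one observed at \<open>x\<close> at time \<open>t\<close>, so the events that define
  the two laws are the same sets.\<close>

lemma pointwise_statistics_along_characteristics:
  fixes c :: "real \<Rightarrow> real ^ 'n"
  assumes c: "\<And>i. continuous_on UNIV (\<lambda>x. c x $ i)"
    and u: "\<And>\<omega>. \<omega> \<in> space \<mu> \<Longrightarrow> solves_decoupled c (v0 \<omega>) (\<lambda>t x. u t x \<omega>)"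
    and \<phi>: "pointwise_statistics \<mu> u \<phi>"
    and t: "t > 0"
  shows "\<exists>X. X t = x \<and> (\<forall>i. ((\<lambda>s. X s $ i) has_real_derivative c (x $ i) $ i) (at t)) \<and>
    (\<forall>\<^sub>F s in nhds t. \<phi> s (X s) = \<phi> t x)"
proof -
  have "\<exists>Y. Y t = x $ i \<and> (Y has_real_derivative c (x $ i) $ i) (at t) \<and>
    (\<forall>\<^sub>F s in nhds t. \<forall>v0 v. solves_decoupled c v0 v \<longrightarrow> v s (Y s) $ i = v t (x $ i) $ i)" for i
    by (rule decoupled_constant_on_characteristic[OF t c])
  then have "\<exists>Y. \<forall>i. Y i t = x $ i \<and> (Y i has_real_derivative c (x $ i) $ i) (at t) \<and>
    (\<forall>\<^sub>F s in nhds t. \<forall>v0 v. solves_decoupled c v0 v \<longrightarrow> v s (Y i s) $ i = v t (x $ i) $ i)"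
    by (intro choice allI)
  then obtain Y where Y: "\<And>i. Y i t = x $ i" "\<And>i. (Y i has_real_derivative c (x $ i) $ i) (at t)"
    "\<And>i. \<forall>\<^sub>F s in nhds t. \<forall>v0 v. solves_decoupled c v0 v \<longrightarrow> v s (Y i s) $ i = v t (x $ i) $ i"
    by blast
  define X where "X s = (\<chi> i. Y i s)" for s
  \<comment> \<open>Finitely many indices, hence a common neighbourhood of times for all
    components.\<close>
  have "\<forall>\<^sub>F s in nhds t. \<forall>i. \<forall>v0 v. solves_decoupled c v0 v \<longrightarrow> v s (Y i s) $ i = v t (x $ i) $ i"
    by (rule eventually_all_finite[OF Y(3)])
  moreover have "\<forall>\<^sub>F s in nhds t. s > 0"
    using eventually_nhds_in_open[of "{0<..}" t] t by simp
  ultimately have "\<forall>\<^sub>F s in nhds t. \<phi> s (X s) = \<phi> t x"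
  proof eventually_elim
    case (elim s)
    have eq: "(\<chi> i. u s (X s $ i) \<omega> $ i) = (\<chi> i. u t (x $ i) \<omega> $ i)" if "\<omega> \<in> space \<mu>" for \<omega>
      using elim(1) u[OF that] by (auto simp: vec_eq_iff X_def)
    have s: "prob_space (\<phi> s (X s))" "sets (\<phi> s (X s)) = sets borel"
      "\<And>A. A \<in> sets borel \<Longrightarrow> measure (\<phi> s (X s)) A = measure \<mu> {\<omega> \<in> space \<mu>. (\<chi> i. u s (X s $ i) \<omega> $ i) \<in> A}"
      using \<phi> elim(2) unfolding pointwise_statistics_def by auto
    have t: "prob_space (\<phi> t x)" "sets (\<phi> t x) = sets borel"
      "\<And>A. A \<in> sets borel \<Longrightarrow> measure (\<phi> t x) A = measure \<mu> {\<omega> \<in> space \<mu>. (\<chi> i. u t (x $ i) \<omega> $ i) \<in> A}"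
      using \<phi> \<open>t > 0\<close> unfolding pointwise_statistics_def by auto
    show ?case
    proof (rule measure_eqI)
      fix A assume "A \<in> sets (\<phi> s (X s))"
      then have "A \<in> sets borel"
        by (simp only: s(2))
      then have "measure (\<phi> s (X s)) A = measure (\<phi> t x) A"
        by (simp add: s(3) t(3) eq cong: conj_cong)
      then show "emeasure (\<phi> s (X s)) A = emeasure (\<phi> t x) A"
        using s(1) t(1) by (simp add: finite_measure.emeasure_eq_measure prob_space.finite_measure)
    qed (simp only: s(2) t(2))
  qed
  with Y show ?thesis
    by (intro exI[of _ X]) (simp add: X_def vec_eq_iff)
qed

lemma is_density_measurable:
  assumes "is_density \<phi> f" "t \<ge> 0"
  shows "f t x \<in> borel_measurable borel"
proof -
  have "(\<lambda>U. (t, x, U)) \<in> borel \<rightarrow>\<^sub>M restrict_space borel ({0..} \<times> UNIV)"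
    using assms(2)
    by (intro measurable_restrict_space2 borel_measurable_continuous_onI continuous_intros) auto
  moreover have "(\<lambda>(t, x, U). f t x U) \<in> borel_measurable (restrict_space borel ({0..} \<times> UNIV))"
    using assms(1) unfolding is_density_def by simp
  ultimately have "(\<lambda>U. case (t, x, U) of (t, x, U) \<Rightarrow> f t x U) \<in> borel_measurable borel"
    by (rule measurable_compose)
  then show ?thesis
    by simp
qed

text \<open>Equal laws have densities that agree almost everywhere, with a null set that depends on
  the time. Restricting to a sequence of times keeps the union of these sets null.\<close>

lemma density_along_characteristics:
  fixes c :: "real \<Rightarrow> real ^ 'n"
  assumes c: "\<And>i. continuous_on UNIV (\<lambda>x. c x $ i)"
    and u: "\<And>\<omega>. \<omega> \<in> space \<mu> \<Longrightarrow> solves_decoupled c (v0 \<omega>) (\<lambda>t x. u t x \<omega>)"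
    and \<phi>: "pointwise_statistics \<mu> u \<phi>"
    and f: "is_density \<phi> f"
    and t: "t > 0"
  shows "\<exists>X \<sigma> N. X t = x \<and> (\<forall>i. ((\<lambda>s. X s $ i) has_real_derivative c (x $ i) $ i) (at t)) \<and>
    filterlim \<sigma> (at t) sequentially \<and> (\<forall>n::nat. \<sigma> n > 0) \<and>
    (\<forall>n\<ge>N. AE U in lborel. f (\<sigma> n) (X (\<sigma> n)) U = f t x U)"
proof -
  obtain X where X: "X t = x" "\<And>i. ((\<lambda>s. X s $ i) has_real_derivative c (x $ i) $ i) (at t)"
    "\<forall>\<^sub>F s in nhds t. \<phi> s (X s) = \<phi> t x"
    using pointwise_statistics_along_characteristics[OF c u \<phi> t] by blast
  \<comment> \<open>Approaching from the right keeps every \<open>\<sigma> n\<close> positive and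
    different from \<open>t\<close>, as the filter \<open>at t\<close> demands.\<close>
  define \<sigma> where "\<sigma> n = t + inverse (real (Suc n))" for n
  have "\<sigma> \<longlonglongrightarrow> t"
    unfolding \<sigma>_def by (rule LIMSEQ_inverse_real_of_nat_add)
  then have \<sigma>: "filterlim \<sigma> (at t) sequentially"
    by (intro filterlim_atI) (auto simp: \<sigma>_def)
  have pos: "\<sigma> n > 0" for n
    using t by (simp add: \<sigma>_def add_pos_pos)
  have "\<forall>\<^sub>F n in sequentially. \<phi> (\<sigma> n) (X (\<sigma> n)) = \<phi> t x"
    using X(3) \<open>\<sigma> \<longlonglongrightarrow> t\<close> by (rule eventually_compose_filterlim)
  then obtain N where N: "\<And>n. n \<ge> N \<Longrightarrow> \<phi> (\<sigma> n) (X (\<sigma> n)) = \<phi> t x"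
    unfolding eventually_sequentially by blast
  have "AE U in lborel. f (\<sigma> n) (X (\<sigma> n)) U = f t x U" if "n \<ge> N" for n
  proof -
    have dens: "\<phi> s y = density lborel (\<lambda>U. ennreal (f s y U))" "\<And>U. 0 \<le> f s y U" if "s > 0" for s y
      using f that unfolding is_density_def by auto
    have [measurable]: "f s y \<in> borel_measurable borel" if "s > 0" for s y
      using is_density_measurable[OF f, of s y] that by simp
    \<comment> \<open>Densities with respect to a sigma-finite measure are unique almost everywhere;
      nonnegativity then removes \<open>ennreal\<close>.\<close>
    have "AE U in lborel. ennreal (f (\<sigma> n) (X (\<sigma> n)) U) = ennreal (f t x U)"
      using N[OF that] pos[of n] t
      by (intro iffD1[OF sigma_finite_measure.density_unique_iff[OF sigma_finite_lborel]])
        (auto simp: dens(1))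
    then show ?thesis
      by eventually_elim (use dens(2) pos t in simp)
  qed
  with X(1,2) \<sigma> pos show ?thesis
    by blast
qed

text \<open>Off a countable union of null sets, \<open>U\<close> satisfies all the equalities along
  the sequence at once. This union depends on \<open>(t, x)\<close>, so the almost-everywhere
  quantifier stays inside those over \<open>t\<close> and \<open>x\<close>.\<close>

lemma AE_transport_zero:
  fixes c :: "real \<Rightarrow> real ^ 'n"
  assumes c: "\<And>i. continuous_on UNIV (\<lambda>x. c x $ i)"
    and u: "\<And>\<omega>. \<omega> \<in> space \<mu> \<Longrightarrow> solves_decoupled c (v0 \<omega>) (\<lambda>t x. u t x \<omega>)"
    and \<phi>: "pointwise_statistics \<mu> u \<phi>"
    and f: "is_density \<phi> f"
    and t: "t > 0"
  shows "AE U in lborel. (\<lambda>(s, y). f s y U) differentiable (at (t, x)) \<longrightarrow> transport_operator c f t x U = 0"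
proof -
  from density_along_characteristics[OF c u \<phi> f t] obtain X \<sigma> N where
    X: "X t = x" "\<And>i. ((\<lambda>s. X s $ i) has_real_derivative c (x $ i) $ i) (at t)"
    and \<sigma>: "filterlim \<sigma> (at t) sequentially"
    and AE: "\<And>n. n \<ge> N \<Longrightarrow> AE U in lborel. f (\<sigma> n) (X (\<sigma> n)) U = f t x U"
    by blast
  from AE have "AE U in lborel. \<forall>n. n \<ge> N \<longrightarrow> f (\<sigma> n) (X (\<sigma> n)) U = f t x U"
    unfolding AE_all_countable by auto
  then show ?thesis
  proof eventually_elim
    case (elim U)
    then show ?case
      unfolding transport_operator_def
      by (intro impI transport_zero_along_curve[where \<sigma> = \<sigma> and X = X] X \<sigma>)
        (auto simp: eventually_sequentially)
  qed
qed

text \<open>The set where the two functions differ is open and Lebesgue null, hence empty.\<close>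

lemma continuous_AE_lborel_eq:
  fixes g h :: "'a::euclidean_space \<Rightarrow> 'b::t2_space"
  assumes "continuous_on UNIV g" "continuous_on UNIV h" "AE U in lborel. g U = h U"
  shows "g = h"
proof -
  have op: "open {U. g U \<noteq> h U}"
    by (rule open_Collect_neq[OF assms(1,2)])
  then have "{U. g U \<noteq> h U} \<in> null_sets lborel"
    using assms(3) by (subst (asm) AE_iff_null) auto
  then have "negligible {U. g U \<noteq> h U}"
    unfolding negligible_iff_null_sets by (rule null_sets_completionI)
  then have "{U. g U \<noteq> h U} = {}"
    using open_not_negligible[OF op] by blast
  then show ?thesis
    by auto
qed

text \<open>Continuity in \<open>U\<close>, at time \<open>t\<close> and at the times of the
  sequence, upgrades equality almost everywhere to equality, which leaves no exceptional
  \<open>U\<close>.\<close>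

lemma continuous_transport_zero:
  fixes c :: "real \<Rightarrow> real ^ 'n"
  assumes c: "\<And>i. continuous_on UNIV (\<lambda>x. c x $ i)"
    and u: "\<And>\<omega>. \<omega> \<in> space \<mu> \<Longrightarrow> solves_decoupled c (v0 \<omega>) (\<lambda>t x. u t x \<omega>)"
    and \<phi>: "pointwise_statistics \<mu> u \<phi>"
    and f: "is_density \<phi> f"
    and cont: "\<And>t x. t > 0 \<Longrightarrow> continuous_on UNIV (f t x)"
    and t: "t > 0"
    and diff: "(\<lambda>(s, y). f s y U) differentiable (at (t, x))"
  shows "transport_operator c f t x U = 0"
proof -
  from density_along_characteristics[OF c u \<phi> f t] obtain X \<sigma> N where
    X: "X t = x" "\<And>i. ((\<lambda>s. X s $ i) has_real_derivative c (x $ i) $ i) (at t)"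
    and \<sigma>: "filterlim \<sigma> (at t) sequentially" and pos: "\<And>n. \<sigma> n > 0"
    and AE: "\<And>n. n \<ge> N \<Longrightarrow> AE U in lborel. f (\<sigma> n) (X (\<sigma> n)) U = f t x U"
    by blast
  have "f (\<sigma> n) (X (\<sigma> n)) = f t x" if "n \<ge> N" for n
    by (rule continuous_AE_lborel_eq[OF cont[OF pos] cont[OF t] AE[OF that]])
  then show ?thesis
    unfolding transport_operator_def
    by (intro transport_zero_along_curve[where \<sigma> = \<sigma> and X = X] X \<sigma> diff)
      (auto simp: eventually_sequentially intro!: exI[of _ N])
qed

section \<open>Integrals of derivatives and joint measurability\<close>

lemma lborel_translation:
  fixes h :: "'a::euclidean_space \<Rightarrow> real"
  assumes "integrable lborel h"
  shows "integrable lborel (\<lambda>z. h (a + z))" "(\<integral>z. h (a + z) \<partial>lborel) = (\<integral>z. h z \<partial>lborel)"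
proof -
  have h: "h \<in> borel_measurable borel" and a: "(+) a \<in> lborel \<rightarrow>\<^sub>M borel"
    using assms by auto
  show "integrable lborel (\<lambda>z. h (a + z))"
    using integrable_distr_eq[OF a h] assms by (simp add: lborel_distr_plus)
  show "(\<integral>z. h (a + z) \<partial>lborel) = (\<integral>z. h z \<partial>lborel)"
    using integral_distr[OF a h] by (simp add: lborel_distr_plus)
qed

text \<open>By translation invariance the difference quotients in direction \<open>e\<close> have integral \<open>0\<close>; pass
  to the limit by dominated convergence.\<close>

lemma integral_line_derivative_zero:
  fixes h d :: "'a::euclidean_space \<Rightarrow> real"
  assumes int: "integrable lborel h"
    and K: "compact K" "\<And>z. z \<notin> K \<Longrightarrow> h z = 0"
    and d: "\<And>z. ((\<lambda>s. h (z + s *\<^sub>R e)) has_real_derivative d z) (at 0)"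
    and M: "\<And>z. \<bar>d z\<bar> \<le> M"
  shows "has_bochner_integral lborel d 0"
proof -
  \<comment> \<open>Differentiability at parameter \<open>0\<close> for every base point gives
    differentiability along the whole line, by shifting the base point.\<close>
  have line: "((\<lambda>s. h (z + s *\<^sub>R e)) has_real_derivative d (z + s *\<^sub>R e)) (at s)" for z s
    using d[of "z + s *\<^sub>R e"] DERIV_shift[of "\<lambda>s. h (z + s *\<^sub>R e)" "d (z + s *\<^sub>R e)" 0 s]
    by (simp add: algebra_simps)
  have lip: "\<bar>h (z + s *\<^sub>R e) - h z\<bar> \<le> s * M" if pos: "s > 0" for z s
  proof -
    obtain r where "h (z + s *\<^sub>R e) - h (z + 0 *\<^sub>R e) = (s - 0) * d (z + r *\<^sub>R e)"
      using MVT2[of 0 s "\<lambda>s. h (z + s *\<^sub>R e)" "\<lambda>s. d (z + s *\<^sub>R e)"] pos line by blast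
    then show ?thesis
      using M[of "z + r *\<^sub>R e"] pos by (simp add: abs_mult)
  qed
  define a where "a n = inverse (real (Suc n))" for n
  have a: "0 < a n" "a n \<le> 1" for n
    by (simp_all add: a_def field_simps)
  define q where "q n z = (h (a n *\<^sub>R e + z) - h z) / a n" for n z
  \<comment> \<open>\<open>K\<close> swept backwards along \<open>e\<close> for times up to
    \<open>1\<close>. As \<open>a n \<le> 1\<close>, it contains every point where some
    \<open>q n\<close> is nonzero, so one integrable bound serves all of them.\<close>
  define K2 where "K2 = (\<lambda>(x, s). x - s *\<^sub>R e) ` (K \<times> {0..1::real})"
  have K2: "compact K2"
    unfolding K2_def case_prod_unfold
    by (intro compact_continuous_image continuous_intros compact_Times K(1)) simp
  have q_bound: "norm (q n z) \<le> M * indicator K2 z" for n z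
  proof (cases "z \<in> K2")
    case True
    have "\<bar>h (a n *\<^sub>R e + z) - h z\<bar> \<le> a n * M"
      using lip[OF a(1), of z n] by (simp only: add.commute)
    then show ?thesis
      using a(1)[of n] True by (simp add: q_def field_simps)
  next
    case False
    have "z \<notin> K"
    proof
      assume "z \<in> K"
      then have "z \<in> K2"
        unfolding K2_def by (intro image_eqI[of _ _ "(z, 0)"]) auto
      with False show False ..
    qed
    moreover have "a n *\<^sub>R e + z \<notin> K"
    proof
      assume "a n *\<^sub>R e + z \<in> K"
      then have "z \<in> K2"
        unfolding K2_def using a[of n] by (intro image_eqI[of _ _ "(a n *\<^sub>R e + z, a n)"]) auto
      with False show False ..
    qed
    ultimately show ?thesis
      using False K(2) by (simp add: q_def)
  qed
  have q_int: "integrable lborel (q n)" "(\<integral>z. q n z \<partial>lborel) = 0" for n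
    unfolding q_def using lborel_translation[OF int, of "a n *\<^sub>R e"] int by simp_all
  have q_lim: "(\<lambda>n. q n z) \<longlonglongrightarrow> d z" for z
  proof -
    have "a \<longlonglongrightarrow> 0"
      unfolding a_def by (rule LIMSEQ_inverse_real_of_nat)
    then have "filterlim a (at 0) sequentially"
      using a(1) by (intro filterlim_atI) (auto simp: less_imp_neq[symmetric])
    from filterlim_compose[OF has_field_derivativeD[OF d] this]
    show ?thesis
      by (simp add: q_def add.commute)
  qed
  have [measurable]: "q n \<in> borel_measurable lborel" for n
    using q_int(1) by (rule borel_measurable_integrable)
  have [measurable]: "d \<in> borel_measurable lborel"
    by (rule borel_measurable_LIMSEQ_metric[OF _ q_lim]) simp
  have w: "integrable lborel (\<lambda>z. M * indicator K2 z)"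
    using emeasure_compact_finite[OF K2] borel_compact[OF K2]
    by (intro integrable_mult_right integrable_real_indicator) auto
  have "integrable lborel d"
    by (rule integrable_dominated_convergence[where s = q, OF _ _ w]) (use q_lim q_bound in auto)
  moreover have "(\<lambda>n. \<integral>z. q n z \<partial>lborel) \<longlonglongrightarrow> (\<integral>z. d z \<partial>lborel)"
    by (rule integral_dominated_convergence[OF _ _ w]) (use q_lim q_bound in auto)
  then have "(\<integral>z. d z \<partial>lborel) = 0"
    using q_int(2) by (simp add: LIMSEQ_const_iff)
  ultimately show ?thesis
    by (simp add: has_bochner_integral_iff)
qed

lemma has_derivative_along_line:
  fixes h :: "'a::real_normed_vector \<Rightarrow> real"
  assumes "(h has_derivative L) (at z)"
  shows "((\<lambda>s. h (z + s *\<^sub>R e)) has_real_derivative L e) (at 0)"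
proof -
  have "((\<lambda>s. z + s *\<^sub>R e) has_derivative (\<lambda>s. s *\<^sub>R e)) (at 0)"
    by (auto intro!: derivative_eq_intros)
  from has_derivative_compose[OF this, of h L] assms
  have "((\<lambda>s. h (z + s *\<^sub>R e)) has_derivative (\<lambda>s. L (s *\<^sub>R e))) (at 0)"
    by simp
  moreover have "(\<lambda>s. L (s *\<^sub>R e)) = (*) (L e)"
    using linear_scale[OF has_derivative_linear[OF assms]] by (auto simp: mult.commute)
  ultimately show ?thesis
    by (simp only: has_field_derivative_def)
qed

text \<open>Derivatives are given only on \<open>S\<close>, in the application the region
  \<open>t > 0\<close>. Since \<open>h\<close> vanishes on the open complement of \<open>K\<close>,
  it has derivative \<open>0\<close> there, so the conditional expression is the directional
  derivative of \<open>h\<close> at every point.\<close>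

lemma integral_directional_derivative_zero:
  fixes h :: "'a::euclidean_space \<Rightarrow> real"
  assumes K: "compact K" "K \<subseteq> S" "\<And>z. z \<notin> K \<Longrightarrow> h z = 0"
    and h': "\<And>z. z \<in> S \<Longrightarrow> (h has_derivative h' z) (at z)"
    and cont: "continuous_on S (\<lambda>z. h' z e)"
  shows "has_bochner_integral lborel (\<lambda>z. if z \<in> S then h' z e else 0) 0"
proof -
  let ?d = "\<lambda>z. if z \<in> S then h' z e else 0"
  have off: "(h has_derivative (\<lambda>_. 0)) (at z)" if "z \<notin> K" for z
  proof (rule has_derivative_transform_within_open[where f = "\<lambda>_. 0"])
    show "open (- K)"
      by (rule open_Compl[OF compact_imp_closed[OF K(1)]])
  qed (use that K(3) in auto)
  have Fr: "\<exists>L. (h has_derivative L) (at z) \<and> L e = ?d z" for z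
  proof (cases "z \<in> S")
    case True
    then show ?thesis
      using h' by auto
  next
    case False
    then have "z \<notin> K"
      using K(2) by blast
    then show ?thesis
      using off False by (intro exI[of _ "\<lambda>_. 0"]) auto
  qed
  have line: "((\<lambda>s. h (z + s *\<^sub>R e)) has_real_derivative ?d z) (at 0)" for z
  proof -
    obtain L where L: "(h has_derivative L) (at z)" "L e = ?d z"
      using Fr by blast
    from has_derivative_along_line[OF L(1), of e] show ?thesis
      by (simp only: L(2))
  qed
  \<comment> \<open>Uniqueness of derivatives forces \<open>h' z\<close> to vanish on
    \<open>S\<close> outside \<open>K\<close>; a bound on the compact \<open>K\<close> is therefore
    global.\<close>
  have zero: "?d z = 0" if "z \<notin> K" for z
    using has_derivative_unique[OF h' off[OF that]] by (cases "z \<in> S") auto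
  have "bounded ((\<lambda>z. h' z e) ` K)"
    by (intro compact_imp_bounded compact_continuous_image continuous_on_subset[OF cont] K)
  then obtain M where M: "M > 0" "\<And>z. z \<in> K \<Longrightarrow> \<bar>h' z e\<bar> \<le> M"
    unfolding bounded_pos by auto
  have bound: "\<bar>?d z\<bar> \<le> M" for z
    using zero[of z] M K(2) by (cases "z \<in> K") auto
  have "continuous_on K h"
    using h' K(2) by (intro continuous_at_imp_continuous_on ballI has_derivative_continuous) blast
  from borel_integrable_compact[OF K(1) this]
  have "integrable lborel (\<lambda>z. indicator K z *\<^sub>R h z)" .
  moreover have "(\<lambda>z. indicator K z *\<^sub>R h z) = h"
    using K(3) by (auto simp: fun_eq_iff indicator_def)
  ultimately have "integrable lborel h"
    by simp
  from integral_line_derivative_zero[OF this K(1,3) line bound] show ?thesis .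
qed

text \<open>The rounding error is at most the mesh \<open>1 / Suc n\<close>. Floors are measurable
  and take countably many values, which is what the grid argument below uses.\<close>

lemma floor_approx_tendsto: "(\<lambda>n. of_int \<lfloor>real (Suc n) * y\<rfloor> / real (Suc n)) \<longlonglongrightarrow> y"
proof (rule LIMSEQ_I)
  fix e :: real assume "e > 0"
  then obtain N where N: "inverse (real (Suc N)) < e"
    using reals_Archimedean by blast
  have "norm (of_int \<lfloor>real (Suc n) * y\<rfloor> / real (Suc n) - y) < e" if "n \<ge> N" for n
  proof -
    have "\<bar>of_int \<lfloor>real (Suc n) * y\<rfloor> - real (Suc n) * y\<bar> \<le> 1"
      by linarith
    then have "\<bar>of_int \<lfloor>real (Suc n) * y\<rfloor> - real (Suc n) * y\<bar> / real (Suc n) \<le> inverse (real (Suc n))"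
      using divide_right_mono[of "\<bar>of_int \<lfloor>real (Suc n) * y\<rfloor> - real (Suc n) * y\<bar>" 1 "real (Suc n)"]
      by (simp only: inverse_eq_divide of_nat_0_le_iff simp_thms)
    also have "\<dots> \<le> inverse (real (Suc N))"
      using that by (simp add: field_simps)
    finally have "\<bar>of_int \<lfloor>real (Suc n) * y\<rfloor> - real (Suc n) * y\<bar> / real (Suc n) < e"
      using N by simp
    moreover have "of_int \<lfloor>real (Suc n) * y\<rfloor> / real (Suc n) - y
        = (of_int \<lfloor>real (Suc n) * y\<rfloor> - real (Suc n) * y) / real (Suc n)"
      by (simp add: field_simps)
    ultimately show ?thesis
      by (simp only: real_norm_def abs_divide abs_of_nat)
  qed
  then show "\<exists>N. \<forall>n\<ge>N. norm (of_int \<lfloor>real (Suc n) * y\<rfloor> / real (Suc n) - y) < e"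
    by blast
qed

text \<open>\<open>F\<close> is the limit of its evaluations at the grid points below \<open>(t, x)\<close>.\<close>

lemma caratheodory_measurable:
  fixes F :: "real \<Rightarrow> real \<Rightarrow> 'w \<Rightarrow> 'b::metric_space"
  assumes meas: "\<And>t x. F t x \<in> borel_measurable M"
    and cont: "\<And>\<omega>. \<omega> \<in> space M \<Longrightarrow> continuous_on UNIV (\<lambda>(t, x). F t x \<omega>)"
  shows "(\<lambda>p. F (fst (fst p)) (snd (fst p)) (snd p)) \<in> borel_measurable ((borel \<Otimes>\<^sub>M borel) \<Otimes>\<^sub>M M)"
proof -
  let ?N = "(borel \<Otimes>\<^sub>M borel) \<Otimes>\<^sub>M M :: ((real \<times> real) \<times> 'w) measure"
  define r where "r n k = real_of_int k / real (Suc n)" for n k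
  let ?G = "\<lambda>n p. F (r n \<lfloor>real (Suc n) * fst (fst p)\<rfloor>) (r n \<lfloor>real (Suc n) * snd (fst p)\<rfloor>) (snd p)"
  \<comment> \<open>Both grid indices are integers, so they can be fixed one after the other; what
    remains is \<open>F\<close> at a fixed point, covered by \<open>meas\<close>.\<close>
  have G: "?G n \<in> borel_measurable ?N" for n
  proof (rule measurable_compose_countable[where f = "\<lambda>j p. F (r n j) (r n \<lfloor>real (Suc n) * snd (fst p)\<rfloor>) (snd p)"])
    fix j :: int
    show "(\<lambda>p. F (r n j) (r n \<lfloor>real (Suc n) * snd (fst p)\<rfloor>) (snd p)) \<in> borel_measurable ?N"
    proof (rule measurable_compose_countable[where f = "\<lambda>k p. F (r n j) (r n k) (snd p)"])
      show "(\<lambda>p. F (r n j) (r n k) (snd p)) \<in> borel_measurable ?N" for k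
        by (rule measurable_compose[OF measurable_snd meas])
    qed measurable
  qed measurable
  show ?thesis
  proof (rule borel_measurable_LIMSEQ_metric[OF G])
    fix p assume "p \<in> space ?N"
    then have "snd p \<in> space M"
      by (auto simp: space_pair_measure)
    from cont[OF this] have "isCont (\<lambda>(t, x). F t x (snd p)) (fst p)"
      by (simp only: continuous_on_eq_continuous_at[OF open_UNIV] UNIV_I ball_simps simp_thms)
    moreover have "(\<lambda>n. (r n \<lfloor>real (Suc n) * fst (fst p)\<rfloor>, r n \<lfloor>real (Suc n) * snd (fst p)\<rfloor>))
      \<longlonglongrightarrow> (fst (fst p), snd (fst p))"
      unfolding r_def by (intro tendsto_Pair floor_approx_tendsto)
    ultimately show "(\<lambda>n. ?G n p) \<longlonglongrightarrow> F (fst (fst p)) (snd (fst p)) (snd p)"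
      using isCont_tendsto_compose by (fastforce simp: case_prod_unfold)
  qed
qed

section \<open>The weak equation\<close>

text \<open>Off the compact \<open>K\<close> the function is \<open>0\<close> on an open set, so its
  derivative vanishes there too, and one \<open>K\<close> supports both.\<close>

lemma test_function_derivative:
  fixes \<psi> :: "real \<Rightarrow> real ^ 'n \<Rightarrow> real ^ 'n \<Rightarrow> real"
  assumes "test_function \<psi>"
  shows "\<exists>\<psi>' K. continuous_on UNIV \<psi>' \<and>
    (\<forall>z. ((\<lambda>(t, x, U). \<psi> t x U) has_derivative blinfun_apply (\<psi>' z)) (at z)) \<and>
    compact K \<and> K \<subseteq> {0<..} \<times> UNIV \<and> (\<forall>z. z \<notin> K \<longrightarrow> (case z of (t, x, U) \<Rightarrow> \<psi> t x U) = 0 \<and> \<psi>' z = 0)"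
proof -
  obtain \<psi>' where \<psi>': "continuous_on UNIV \<psi>'"
    "\<And>z. ((\<lambda>(t, x, U). \<psi> t x U) has_derivative blinfun_apply (\<psi>' z)) (at z)"
    using assms unfolding test_function_def C1_on_def by blast
  obtain K where K: "compact K" "K \<subseteq> {0<..} \<times> UNIV" "\<And>t x U. (t, x, U) \<notin> K \<Longrightarrow> \<psi> t x U = 0"
    using assms unfolding test_function_def by blast
  have zero: "(case z of (t, x, U) \<Rightarrow> \<psi> t x U) = 0" if "z \<notin> K" for z
    using K(3) that by (auto split: prod.splits)
  have "\<psi>' z = 0" if "z \<notin> K" for z
  proof -
    have "((\<lambda>(t, x, U). \<psi> t x U) has_derivative (\<lambda>_. 0)) (at z)"
    proof (rule has_derivative_transform_within_open[where f = "\<lambda>_. 0"])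
      show "open (- K)"
        by (rule open_Compl[OF compact_imp_closed[OF K(1)]])
    qed (use that zero in auto)
    from has_derivative_unique[OF \<psi>'(2) this] show ?thesis
      by (intro blinfun_eqI) simp
  qed
  with \<psi>' K(1,2) zero show ?thesis
    by blast
qed

text \<open>Minus the formal adjoint of \<open>transport_operator c\<close>: the factor that
  multiplies \<open>f\<close> in \<open>transport_distributional\<close>.\<close>

definition transport_adjoint ::
  "(real \<Rightarrow> real ^ 'n) \<Rightarrow> (real \<Rightarrow> real ^ 'n \<Rightarrow> real ^ 'n \<Rightarrow> real)
    \<Rightarrow> real \<Rightarrow> real ^ 'n \<Rightarrow> real ^ 'n \<Rightarrow> real" where
  "transport_adjoint c \<psi> t x U =
     deriv (\<lambda>s. \<psi> s x U) t + (\<Sum>i\<in>UNIV. partial_deriv i (\<lambda>y. c (y $ i) $ i * \<psi> t y U) x)"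

text \<open>Product rule: moving along \<open>axis i 1\<close> changes only coordinate
  \<open>i\<close>, so the coefficient contributes an ordinary derivative. Continuity and vanishing
  outside the support can be read off from this form.\<close>

lemma transport_adjoint_eq:
  fixes \<psi> :: "real \<Rightarrow> real ^ 'n \<Rightarrow> real ^ 'n \<Rightarrow> real"
  assumes \<psi>': "\<And>z. ((\<lambda>(t, x, U). \<psi> t x U) has_derivative blinfun_apply (\<psi>' z)) (at z)"
    and c': "\<And>i x. ((\<lambda>x. c x $ i) has_real_derivative c' i x) (at x)"
  shows "transport_adjoint c \<psi> t x U = blinfun_apply (\<psi>' (t, x, U)) (1, 0, 0) +
    (\<Sum>i\<in>UNIV. c' i (x $ i) * \<psi> t x U + c (x $ i) $ i * blinfun_apply (\<psi>' (t, x, U)) (0, axis i 1, 0))"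
proof -
  have "((\<lambda>s. \<psi> (t + s) x U) has_real_derivative blinfun_apply (\<psi>' (t, x, U)) (1, 0, 0)) (at 0)"
    using has_derivative_along_line[OF \<psi>', of "(t, x, U)" "(1, 0, 0)"] by simp
  then have "((\<lambda>s. \<psi> s x U) has_real_derivative blinfun_apply (\<psi>' (t, x, U)) (1, 0, 0)) (at t)"
    using DERIV_shift[of "\<lambda>s. \<psi> s x U" _ 0 t] by (simp add: add.commute)
  then have dt: "deriv (\<lambda>s. \<psi> s x U) t = blinfun_apply (\<psi>' (t, x, U)) (1, 0, 0)"
    by (rule DERIV_imp_deriv)
  have "partial_deriv i (\<lambda>y. c (y $ i) $ i * \<psi> t y U) x
      = c' i (x $ i) * \<psi> t x U + c (x $ i) $ i * blinfun_apply (\<psi>' (t, x, U)) (0, axis i 1, 0)" for i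
  proof -
    have 1: "((\<lambda>s. \<psi> t (x + s *\<^sub>R axis i 1) U) has_real_derivative
        blinfun_apply (\<psi>' (t, x, U)) (0, axis i 1, 0)) (at 0)"
      using has_derivative_along_line[OF \<psi>', of "(t, x, U)" "(0, axis i 1, 0)"] by simp
    have 2: "((\<lambda>s. c (x $ i + s) $ i) has_real_derivative c' i (x $ i)) (at 0)"
      using c'[of i "x $ i"] DERIV_shift[of "\<lambda>y. c y $ i" _ 0 "x $ i"] by (simp add: add.commute)
    have "((\<lambda>s. c ((x + s *\<^sub>R axis i 1) $ i) $ i * \<psi> t (x + s *\<^sub>R axis i 1) U) has_real_derivative
        c' i (x $ i) * \<psi> t x U + c (x $ i) $ i * blinfun_apply (\<psi>' (t, x, U)) (0, axis i 1, 0)) (at 0)"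
      using DERIV_mult[OF 2 1] by (simp add: algebra_simps)
    then show ?thesis
      unfolding partial_deriv_def by (rule DERIV_imp_deriv)
  qed
  then show ?thesis
    by (simp only: transport_adjoint_def dt)
qed

text \<open>For a single realisation the chain rule and the equation turn \<open>transport_adjoint c \<psi>\<close>,
  evaluated along the observed values, into a divergence.\<close>

lemma transport_adjoint_integral_zero:
  fixes c :: "real \<Rightarrow> real ^ 'n"
  assumes v: "solves_decoupled c v0 v"
    and c': "\<And>i x. ((\<lambda>x. c x $ i) has_real_derivative c' i x) (at x)"
      "\<And>i. continuous_on UNIV (c' i)"
    and \<psi>: "test_function \<psi>"
  shows "has_bochner_integral lborel (\<lambda>(t, x). transport_adjoint c \<psi> t x (\<chi> i. v t (x $ i) $ i)) 0"
proof -
  obtain \<psi>' K where \<psi>': "continuous_on UNIV \<psi>'"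
      "\<And>z. ((\<lambda>(t, x, U). \<psi> t x U) has_derivative blinfun_apply (\<psi>' z)) (at z)"
    and K: "compact K" "K \<subseteq> {0<..} \<times> UNIV"
      "\<And>z. z \<notin> K \<Longrightarrow> (case z of (t, x, U) \<Rightarrow> \<psi> t x U) = 0" "\<And>z. z \<notin> K \<Longrightarrow> \<psi>' z = 0"
    using test_function_derivative[OF \<psi>] by blast
  have off: "\<psi> t x U = 0" "\<psi>' (t, x, U) = 0" if "(t, x, U) \<notin> K" for t x U
    using K(3,4)[OF that] by simp_all
  obtain v' where v': "continuous_on ({0<..} \<times> UNIV) v'"
      "\<And>t x. t > 0 \<Longrightarrow> ((\<lambda>(t, x). v t x) has_derivative blinfun_apply (v' (t, x))) (at (t, x))"
    and pde: "\<And>t x i. t > 0 \<Longrightarrow>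
      blinfun_apply (v' (t, x)) (1, 0) $ i + c x $ i * blinfun_apply (v' (t, x)) (0, 1) $ i = 0"
    using solves_decoupled_derivative[OF v] by blast
  define S where "S = ({0<..} :: real set) \<times> (UNIV :: (real ^ 'n) set)"
  \<comment> \<open>The support is projected away from \<open>U\<close> because \<open>U\<close> is
    about to be replaced by values of the solution, over which \<open>K\<close> gives no
    control.\<close>
  define J where "J = (\<lambda>(t, x, U). (t, x)) ` K"
  \<comment> \<open>\<open>V\<close> is the observed vector as a function of
    \<open>p = (t, x)\<close> and \<open>\<Phi>\<close> the test function evaluated at it; the
    primed versions are their derivatives on \<open>S\<close>.\<close>
  define V where "V p = (\<chi> i. v (fst p) (snd p $ i) $ i)" for p :: "real \<times> (real ^ 'n)"
  define V' where "V' p h = (\<chi> i. blinfun_apply (v' (fst p, snd p $ i)) (fst h, snd h $ i) $ i)"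
    for p h :: "real \<times> (real ^ 'n)"
  define \<Phi> where "\<Phi> p = \<psi> (fst p) (snd p) (V p)" for p
  define \<Phi>' where "\<Phi>' p h = blinfun_apply (\<psi>' (fst p, snd p, V p)) (fst h, snd h, V' p h)" for p h
  have J: "compact J" "J \<subseteq> S"
    using K(1,2) by (auto simp: J_def S_def case_prod_unfold intro!: compact_continuous_image continuous_intros)
  have J_off: "(fst p, snd p, U) \<notin> K" if "p \<notin> J" for p U
    using that by (force simp: J_def)
  have \<Phi>_off: "\<Phi> p = 0" if "p \<notin> J" for p
    using off(1)[OF J_off[OF that]] by (simp add: \<Phi>_def)
  have V: "(V has_derivative V' p) (at p)" if "p \<in> S" for p
  proof (rule has_derivative_vec_componentwise)
    fix i
    have "((\<lambda>p. (fst p, snd p $ i)) has_derivative (\<lambda>h. (fst h, snd h $ i))) (at p)"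
      by (intro has_derivative_Pair bounded_linear_imp_has_derivative bounded_linear_fst
          bounded_linear_compose[OF bounded_linear_vec_nth bounded_linear_snd])
    from has_derivative_compose[OF this v'(2)] that
    have "((\<lambda>p. v (fst p) (snd p $ i)) has_derivative
        (\<lambda>h. blinfun_apply (v' (fst p, snd p $ i)) (fst h, snd h $ i))) (at p)"
      by (auto simp: S_def)
    from bounded_linear.has_derivative[OF bounded_linear_vec_nth this]
    show "((\<lambda>p. V p $ i) has_derivative (\<lambda>h. V' p h $ i)) (at p)"
      by (simp add: V_def V'_def)
  qed
  have \<Phi>': "(\<Phi> has_derivative \<Phi>' p) (at p)" if "p \<in> S" for p
  proof -
    have "((\<lambda>p. (fst p, snd p, V p)) has_derivative (\<lambda>h. (fst h, snd h, V' p h))) (at p)"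
      by (intro has_derivative_Pair bounded_linear_imp_has_derivative bounded_linear_fst
          bounded_linear_snd V[OF that])
    from has_derivative_compose[OF this \<psi>'(2)] show ?thesis
      by (simp add: \<Phi>_def[abs_def] \<Phi>'_def[abs_def])
  qed
  have cont_V: "continuous_on S V"
    using V by (intro continuous_at_imp_continuous_on ballI has_derivative_continuous) blast
  have cont_\<Phi>: "continuous_on S \<Phi>"
    using \<Phi>' by (intro continuous_at_imp_continuous_on ballI has_derivative_continuous) blast
  have cont_V': "continuous_on S (\<lambda>p. V' p h)" for h
  proof (rule continuous_on_vec_componentwise)
    fix i
    have "continuous_on S (\<lambda>p. v' (fst p, snd p $ i))"
      by (rule continuous_on_compose2[OF v'(1)]) (auto simp: S_def intro!: continuous_intros)
    then show "continuous_on S (\<lambda>p. V' p h $ i)"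
      unfolding V'_def by (simp, intro continuous_intros)
  qed
  have cont_\<Phi>': "continuous_on S (\<lambda>p. \<Phi>' p h)" for h
  proof -
    have "continuous_on S (\<lambda>p. \<psi>' (fst p, snd p, V p))"
      by (rule continuous_on_compose2[OF \<psi>'(1)]) (auto intro!: continuous_intros cont_V)
    then show ?thesis
      unfolding \<Phi>'_def by (intro continuous_intros cont_V')
  qed
  have int_t: "has_bochner_integral lborel (\<lambda>p. if p \<in> S then \<Phi>' p (1, 0) else 0) 0"
    by (rule integral_directional_derivative_zero[OF J \<Phi>_off \<Phi>' cont_\<Phi>'])
  \<comment> \<open>Space component \<open>i\<close> of the field whose divergence is integrated;
    its time component is \<open>\<Phi>\<close>.\<close>
  define H where "H i p = c (snd p $ i) $ i * \<Phi> p" for i p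
  define H' where "H' i p h = c (snd p $ i) $ i * \<Phi>' p h + c' i (snd p $ i) * snd h $ i * \<Phi> p" for i p h
  have int_x: "has_bochner_integral lborel (\<lambda>p. if p \<in> S then H' i p (0, axis i 1) else 0) 0" for i
  proof (rule integral_directional_derivative_zero[OF J])
    show "H i p = 0" if "p \<notin> J" for p
      using \<Phi>_off[OF that] by (simp add: H_def)
    show "(H i has_derivative H' i p) (at p)" if "p \<in> S" for p
    proof -
      have "((\<lambda>p. snd p $ i) has_derivative (\<lambda>h. snd h $ i)) (at p)"
        by (intro bounded_linear_imp_has_derivative
            bounded_linear_compose[OF bounded_linear_vec_nth bounded_linear_snd])
      from has_derivative_compose[OF this c'(1)[unfolded has_field_derivative_def, of i]]
      have "((\<lambda>p. c (snd p $ i) $ i) has_derivative (\<lambda>h. c' i (snd p $ i) * snd h $ i)) (at p)" .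
      from has_derivative_mult[OF this \<Phi>'[OF that]] show ?thesis
        unfolding H_def[abs_def] H'_def[abs_def] .
    qed
    have c_cont: "continuous_on UNIV (\<lambda>x. c x $ i)"
      using c'(1) by (intro continuous_at_imp_continuous_on ballI DERIV_isCont) blast
    have coeff: "continuous_on S (\<lambda>p. c (snd p $ i) $ i)" "continuous_on S (\<lambda>p. c' i (snd p $ i))"
      by (rule continuous_on_compose2[OF c_cont] continuous_on_compose2[OF c'(2)[of i]];
          auto intro!: continuous_intros)+
    show "continuous_on S (\<lambda>p. H' i p (0, axis i 1))"
      unfolding H'_def
      by (intro continuous_on_add continuous_on_mult continuous_on_const coeff cont_\<Phi> cont_\<Phi>')
  qed
  have "has_bochner_integral lborel (\<lambda>p. (if p \<in> S then \<Phi>' p (1, 0) else 0)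
      + (\<Sum>i\<in>UNIV. if p \<in> S then H' i p (0, axis i 1) else 0)) (0 + (\<Sum>i\<in>(UNIV :: 'n set). 0))"
    by (intro has_bochner_integral_add has_bochner_integral_sum int_t int_x)
  moreover have "(if p \<in> S then \<Phi>' p (1, 0) else 0) + (\<Sum>i\<in>UNIV. if p \<in> S then H' i p (0, axis i 1) else 0)
      = (case p of (t, x) \<Rightarrow> transport_adjoint c \<psi> t x (\<chi> i. v t (x $ i) $ i))" for p
  proof -
    obtain t x where p: "p = (t, x)"
      by fastforce
    let ?L = "blinfun_apply (\<psi>' (t, x, V p))"
    have adj: "(case p of (t, x) \<Rightarrow> transport_adjoint c \<psi> t x (\<chi> i. v t (x $ i) $ i)) =
       ?L (1, 0, 0) + (\<Sum>i\<in>UNIV. c' i (x $ i) * \<Phi> p + c (x $ i) $ i * ?L (0, axis i 1, 0))"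
      by (simp add: p transport_adjoint_eq[OF \<psi>'(2) c'(1)] V_def \<Phi>_def)
    show ?thesis
    proof (cases "p \<in> S")
      case False
      then have "p \<notin> J"
        using J(2) by blast
      then have "\<psi>' (t, x, V p) = 0" "\<Phi> p = 0"
        using off(2)[OF J_off[OF \<open>p \<notin> J\<close>], of "V p"] \<Phi>_off by (auto simp: p)
      then show ?thesis
        unfolding adj using False by simp
    next
      case True
      then have t: "t > 0"
        by (simp add: p S_def)
      \<comment> \<open>The equation for the whole vector \<open>V\<close>: displacing
        \<open>x $ i\<close> affects component \<open>i\<close> alone, so component \<open>j\<close>
        of the sum retains only \<open>i = j\<close>, and the \<open>j\<close>-th scalar equation at
        \<open>x $ j\<close> applies.\<close>
      have "V' p (1, 0) + (\<Sum>i\<in>UNIV. c (x $ i) $ i *\<^sub>R V' p (0, axis i 1)) = 0"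
      proof (subst vec_eq_iff, intro allI)
        fix j
        have zero: "blinfun_apply (v' (t, x $ j)) (0, 0) $ j = 0"
          using blinfun.zero_right[of "v' (t, x $ j)"] by (simp add: zero_prod_def)
        have "(\<Sum>i\<in>UNIV. c (x $ i) $ i * V' p (0, axis i 1) $ j)
          = (\<Sum>i\<in>UNIV. if i = j then c (x $ j) $ j * blinfun_apply (v' (t, x $ j)) (0, 1) $ j else 0)"
          by (rule sum.cong) (auto simp: V'_def p axis_def zero)
        then show "(V' p (1, 0) + (\<Sum>i\<in>UNIV. c (x $ i) $ i *\<^sub>R V' p (0, axis i 1))) $ j = 0 $ j"
          using pde[OF t, of "x $ j" j] by (simp add: V'_def p)
      qed
      \<comment> \<open>Hence the part of the chain rule that passes through the argument
        \<open>U\<close> drops out of the divergence.\<close>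
      then have "?L (0, 0, V' p (1, 0) + (\<Sum>i\<in>UNIV. c (x $ i) $ i *\<^sub>R V' p (0, axis i 1))) = 0"
        using blinfun.zero_right[of "\<psi>' (t, x, V p)"] by (simp add: zero_prod_def)
      moreover have "(0, 0, V' p (1, 0) + (\<Sum>i\<in>UNIV. c (x $ i) $ i *\<^sub>R V' p (0, axis i 1)))
         = (0, 0, V' p (1, 0)) + (\<Sum>i\<in>UNIV. c (x $ i) $ i *\<^sub>R (0 :: real, 0 :: real ^ 'n, V' p (0, axis i 1)))"
        by (simp add: sum_prod)
      ultimately have cancel: "?L (0, 0, V' p (1, 0)) + (\<Sum>i\<in>UNIV. c (x $ i) $ i * ?L (0, 0, V' p (0, axis i 1))) = 0"
        by (simp only: blinfun.add_right blinfun.sum_right blinfun.scaleR_right real_scaleR_def)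
      have split: "?L (a, b, d) = ?L (a, b, 0) + ?L (0, 0, d)" for a b d
        using blinfun.add_right[of "\<psi>' (t, x, V p)" "(a, b, 0)" "(0, 0, d)"] by simp
      have "\<Phi>' p (1, 0) = ?L (1, 0, 0) + ?L (0, 0, V' p (1, 0))"
        using split[of 1 0 "V' p (1, 0)"] by (simp only: \<Phi>'_def p fst_conv snd_conv)
      moreover have "H' i p (0, axis i 1) = (c' i (x $ i) * \<Phi> p + c (x $ i) $ i * ?L (0, axis i 1, 0))
         + c (x $ i) $ i * ?L (0, 0, V' p (0, axis i 1))" for i
      proof -
        have "\<Phi>' p (0, axis i 1) = ?L (0, axis i 1, 0) + ?L (0, 0, V' p (0, axis i 1))"
          using split[of 0 "axis i 1" "V' p (0, axis i 1)"] by (simp only: \<Phi>'_def p fst_conv snd_conv)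
        then show ?thesis
          by (simp add: H'_def p algebra_simps)
      qed
      ultimately show ?thesis
        unfolding adj using True cancel by (simp add: sum.distrib)
    qed
  qed
  ultimately show ?thesis
    by simp
qed

section \<open>Laws of the observations and their expectations\<close>

text \<open>The \<open>\<phi>\<close>-measures of \<open>A\<close> and its complement add up to
  \<open>1\<close>, so one of the two events has nonzero measure and is measurable; the other is its
  complement in \<open>space \<mu>\<close>.\<close>

lemma pointwise_statistics_measurable:
  fixes u :: "real \<Rightarrow> real \<Rightarrow> 'w \<Rightarrow> real ^ 'n"
  assumes \<phi>: "pointwise_statistics \<mu> u \<phi>" and t: "t \<ge> 0"
  shows "(\<lambda>\<omega>. \<chi> i. u t (x $ i) \<omega> $ i) \<in> borel_measurable \<mu>"
proof (rule measurableI)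
  let ?V = "\<lambda>\<omega>. \<chi> i. u t (x $ i) \<omega> $ i"
  have *: "prob_space (\<phi> t x)" "sets (\<phi> t x) = sets borel"
    "\<And>A. A \<in> sets borel \<Longrightarrow> measure (\<phi> t x) A = measure \<mu> {\<omega> \<in> space \<mu>. ?V \<omega> \<in> A}"
    using \<phi> t unfolding pointwise_statistics_def by auto
  interpret prob_space "\<phi> t x"
    by (rule *(1))
  fix A :: "(real ^ 'n) set" assume A: "A \<in> sets borel"
  have sp: "space (\<phi> t x) = UNIV"
    using sets_eq_imp_space_eq[OF *(2)] by simp
  have "measure (\<phi> t x) (- A) = 1 - measure (\<phi> t x) A"
    using prob_compl[of A] A by (simp add: *(2) sp Compl_eq_Diff_UNIV)
  moreover have "measure (\<phi> t x) (- A) = measure \<mu> {\<omega> \<in> space \<mu>. ?V \<omega> \<in> - A}"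
    using A by (intro *(3)) simp
  ultimately have "{\<omega> \<in> space \<mu>. ?V \<omega> \<in> A} \<in> sets \<mu> \<or> {\<omega> \<in> space \<mu>. ?V \<omega> \<in> - A} \<in> sets \<mu>"
    using *(3)[OF A] measure_notin_sets[of "{\<omega> \<in> space \<mu>. ?V \<omega> \<in> A}" \<mu>]
      measure_notin_sets[of "{\<omega> \<in> space \<mu>. ?V \<omega> \<in> - A}" \<mu>] by fastforce
  then show "?V -` A \<inter> space \<mu> \<in> sets \<mu>"
  proof
    assume "{\<omega> \<in> space \<mu>. ?V \<omega> \<in> A} \<in> sets \<mu>"
    moreover have "?V -` A \<inter> space \<mu> = {\<omega> \<in> space \<mu>. ?V \<omega> \<in> A}"
      by auto
    ultimately show ?thesis
      by (simp only:)
  next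
    assume "{\<omega> \<in> space \<mu>. ?V \<omega> \<in> - A} \<in> sets \<mu>"
    moreover have "?V -` A \<inter> space \<mu> = space \<mu> - {\<omega> \<in> space \<mu>. ?V \<omega> \<in> - A}"
      by auto
    ultimately show ?thesis
      by (simp only: sets.compl_sets)
  qed
qed simp

lemma pointwise_statistics_distr:
  assumes "prob_space \<mu>" and \<phi>: "pointwise_statistics \<mu> u \<phi>" and t: "t \<ge> 0"
  shows "\<phi> t x = distr \<mu> borel (\<lambda>\<omega>. \<chi> i. u t (x $ i) \<omega> $ i)"
proof (rule measure_eqI)
  let ?V = "\<lambda>\<omega>. \<chi> i. u t (x $ i) \<omega> $ i"
  interpret prob_space \<mu>
    by fact
  have *: "prob_space (\<phi> t x)" "sets (\<phi> t x) = sets borel"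
    "\<And>A. A \<in> sets borel \<Longrightarrow> measure (\<phi> t x) A = measure \<mu> {\<omega> \<in> space \<mu>. ?V \<omega> \<in> A}"
    using \<phi> t unfolding pointwise_statistics_def by auto
  show "sets (\<phi> t x) = sets (distr \<mu> borel ?V)"
    using *(2) by simp
  fix A assume "A \<in> sets (\<phi> t x)"
  then have A: "A \<in> sets borel"
    by (simp only: *(2))
  interpret phi: prob_space "\<phi> t x"
    by (rule *(1))
  have "?V -` A \<inter> space \<mu> = {\<omega> \<in> space \<mu>. ?V \<omega> \<in> A}"
    by auto
  then show "emeasure (\<phi> t x) A = emeasure (distr \<mu> borel ?V) A"
    using emeasure_distr[OF pointwise_statistics_measurable[OF \<phi> t] A]
    by (simp only: phi.emeasure_eq_measure emeasure_eq_measure *(3)[OF A])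
qed

text \<open>Both sides equal the integral of \<open>g\<close> against \<open>\<phi> t x\<close>,
  once through its density and once as a pushforward of \<open>\<mu>\<close>.\<close>

lemma density_expectation:
  fixes g :: "real ^ 'n \<Rightarrow> real"
  assumes \<mu>: "prob_space \<mu>" and \<phi>: "pointwise_statistics \<mu> u \<phi>" and f: "is_density \<phi> f"
    and t: "t \<ge> 0" and g: "g \<in> borel_measurable borel"
  shows "(\<integral>U. f t x U * g U \<partial>lborel) = (\<integral>\<omega>. g (\<chi> i. u t (x $ i) \<omega> $ i) \<partial>\<mu>)"
proof -
  have [measurable]: "f t x \<in> borel_measurable borel"
    by (rule is_density_measurable[OF f t])
  have dens: "\<phi> t x = density lborel (\<lambda>U. ennreal (f t x U))" "\<And>U. 0 \<le> f t x U"
    using f t unfolding is_density_def by auto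
  have "(\<integral>U. f t x U * g U \<partial>lborel) = (\<integral>U. g U \<partial>\<phi> t x)"
    unfolding dens(1) using g dens(2) by (subst integral_density) auto
  also have "\<dots> = (\<integral>\<omega>. g (\<chi> i. u t (x $ i) \<omega> $ i) \<partial>\<mu>)"
    unfolding pointwise_statistics_distr[OF \<mu> \<phi> t]
    by (rule integral_distr[OF pointwise_statistics_measurable[OF \<phi> t] g])
  finally show ?thesis .
qed

lemma density_nn_integral:
  assumes \<phi>: "pointwise_statistics \<mu> u \<phi>" and f: "is_density \<phi> f" and t: "t \<ge> 0"
  shows "(\<integral>\<^sup>+ U. ennreal (f t x U) \<partial>lborel) = 1"
proof -
  have [measurable]: "f t x \<in> borel_measurable borel"
    by (rule is_density_measurable[OF f t])
  have "prob_space (density lborel (\<lambda>U. ennreal (f t x U)))"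
    using f \<phi> t unfolding is_density_def pointwise_statistics_def by simp
  from prob_space.emeasure_space_1[OF this] show ?thesis
    by (simp add: emeasure_density)
qed

text \<open>The clamping \<open>max 0 t\<close> makes the field continuous on the whole plane.\<close>

lemma observation_measurable:
  fixes u :: "real \<Rightarrow> real \<Rightarrow> 'w \<Rightarrow> real ^ 'n"
  assumes \<phi>: "pointwise_statistics \<mu> u \<phi>"
    and cont: "\<And>\<omega>. \<omega> \<in> space \<mu> \<Longrightarrow> continuous_on ({0..} \<times> UNIV) (\<lambda>(t, x). u t x \<omega>)"
  shows "(\<lambda>p. \<chi> i. u (max 0 (fst (fst p))) (snd (fst p) $ i) (snd p) $ i)
    \<in> borel_measurable ((borel \<Otimes>\<^sub>M borel) \<Otimes>\<^sub>M \<mu>)"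
proof -
  let ?F = "\<lambda>t x \<omega>. u (max 0 t) x \<omega>"
  \<comment> \<open>Observing every component at the same point \<open>x\<close> recovers the full
    vector, whence its measurability.\<close>
  have "?F t x \<in> borel_measurable \<mu>" for t x
    using pointwise_statistics_measurable[OF \<phi>, of "max 0 t" "\<chi> i. x"] by simp
  moreover have "continuous_on UNIV (\<lambda>(t, x). ?F t x \<omega>)" if "\<omega> \<in> space \<mu>" for \<omega>
  proof -
    have "continuous_on UNIV (\<lambda>p. (\<lambda>(t, x). u t x \<omega>) (max 0 (fst p), snd p))"
      by (rule continuous_on_compose2[OF cont[OF that]]) (auto intro!: continuous_intros)
    then show ?thesis
      by (simp add: case_prod_unfold)
  qed
  ultimately have F: "(\<lambda>p. ?F (fst (fst p)) (snd (fst p)) (snd p)) \<in> borel_measurable ((borel \<Otimes>\<^sub>M borel) \<Otimes>\<^sub>M \<mu>)"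
    by (rule caratheodory_measurable)
  have nth: "(\<lambda>v :: real ^ 'n. v $ i) \<in> borel_measurable borel" for i
    by (intro borel_measurable_continuous_onI continuous_intros)
  \<comment> \<open>Component \<open>i\<close> looks only at \<open>x $ i\<close>, so the result for
    a scalar space variable is composed with the extraction of this coordinate.\<close>
  have "(\<lambda>p. u (max 0 (fst (fst p))) (snd (fst p) $ i) (snd p) $ i)
      \<in> borel_measurable ((borel \<Otimes>\<^sub>M (borel :: (real ^ 'n) measure)) \<Otimes>\<^sub>M \<mu>)" for i
  proof -
    have "(\<lambda>p. ((fst (fst p), snd (fst p) $ i), snd p)) \<in>
        (borel \<Otimes>\<^sub>M (borel :: (real ^ 'n) measure)) \<Otimes>\<^sub>M \<mu> \<rightarrow>\<^sub>M (borel \<Otimes>\<^sub>M borel) \<Otimes>\<^sub>M \<mu>"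
      using nth[of i] by measurable
    from measurable_compose[OF measurable_compose[OF this F] nth[of i]] show ?thesis
      by simp
  qed
  then show ?thesis
    by (subst borel_measurable_euclidean_space) (auto simp: Basis_vec_def inner_axis)
qed

text \<open>Supplies the domination for both integrability arguments: a set \<open>J\<close> of
  finite measure in \<open>(t, x)\<close> that does not depend on \<open>U\<close>, and a bound
  \<open>M\<close> uniform in \<open>U\<close>, obtained from compactness of the support in all
  variables.\<close>

lemma transport_adjoint_compact_support:
  fixes c :: "real \<Rightarrow> real ^ 'n"
  assumes c': "\<And>i x. ((\<lambda>x. c x $ i) has_real_derivative c' i x) (at x)"
      "\<And>i. continuous_on UNIV (c' i)"
    and \<psi>: "test_function \<psi>"
  shows "\<exists>J M. compact J \<and> J \<subseteq> {0<..} \<times> UNIV \<and>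
    (\<forall>t x U. (t, x) \<notin> J \<longrightarrow> transport_adjoint c \<psi> t x U = 0) \<and>
    0 < M \<and> (\<forall>t x U. \<bar>transport_adjoint c \<psi> t x U\<bar> \<le> M) \<and>
    continuous_on UNIV (\<lambda>(t, x, U). transport_adjoint c \<psi> t x U)"
proof -
  obtain \<psi>' K where \<psi>': "continuous_on UNIV \<psi>'"
      "\<And>z. ((\<lambda>(t, x, U). \<psi> t x U) has_derivative blinfun_apply (\<psi>' z)) (at z)"
    and K: "compact K" "K \<subseteq> {0<..} \<times> UNIV"
      "\<And>z. z \<notin> K \<Longrightarrow> (case z of (t, x, U) \<Rightarrow> \<psi> t x U) = 0" "\<And>z. z \<notin> K \<Longrightarrow> \<psi>' z = 0"
    using test_function_derivative[OF \<psi>] by blast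
  note adj = transport_adjoint_eq[OF \<psi>'(2) c'(1)]
  let ?g = "\<lambda>(t, x, U). transport_adjoint c \<psi> t x U"
  have off: "transport_adjoint c \<psi> t x U = 0" if "(t, x, U) \<notin> K" for t x U
    using K(3,4)[OF that] by (simp add: adj)
  have cont: "continuous_on UNIV ?g"
  proof -
    have c_cont: "continuous_on UNIV (\<lambda>x. c x $ i)" for i
      using c'(1) by (intro continuous_at_imp_continuous_on ballI DERIV_isCont) blast
    have coeff: "continuous_on UNIV (\<lambda>z :: real \<times> (real ^ 'n) \<times> (real ^ 'n). c (fst (snd z) $ i) $ i)"
      "continuous_on UNIV (\<lambda>z :: real \<times> (real ^ 'n) \<times> (real ^ 'n). c' i (fst (snd z) $ i))" for i
      by (rule continuous_on_compose2[OF c_cont] continuous_on_compose2[OF c'(2)[of i]];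
          auto intro!: continuous_intros)+
    have \<psi>_cont: "continuous_on UNIV (\<lambda>z. \<psi> (fst z) (fst (snd z)) (snd (snd z)))"
      using has_derivative_continuous[OF \<psi>'(2)]
      by (simp add: continuous_on_eq_continuous_within case_prod_unfold)
    show ?thesis
      unfolding adj case_prod_unfold prod.collapse
      by (intro continuous_on_add continuous_on_sum continuous_on_mult continuous_on_const
          bounded_bilinear.continuous_on[OF bounded_bilinear_blinfun_apply] coeff \<psi>_cont \<psi>'(1))
  qed
  have "bounded (?g ` K)"
    by (intro compact_imp_bounded compact_continuous_image continuous_on_subset[OF cont] K(1)) simp
  then obtain M where "M > 0" and M: "\<And>z. z \<in> ?g ` K \<Longrightarrow> norm z \<le> M"
    unfolding bounded_pos by blast
  have "\<bar>transport_adjoint c \<psi> t x U\<bar> \<le> M" for t x U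
  proof (cases "(t, x, U) \<in> K")
    case True
    then have "?g (t, x, U) \<in> ?g ` K"
      by (rule imageI)
    from M[OF this] show ?thesis
      by simp
  qed (use off \<open>M > 0\<close> in simp)
  moreover have "transport_adjoint c \<psi> t x U = 0" if "(t, x) \<notin> (\<lambda>(t, x, U). (t, x)) ` K" for t x U
    using that by (intro off) (force intro: image_eqI[of _ _ "(t, x, U)"])
  moreover have "compact ((\<lambda>(t, x, U). (t, x)) ` K)"
    unfolding case_prod_unfold by (intro compact_continuous_image continuous_intros K(1))
  moreover have "(\<lambda>(t, x, U). (t, x)) ` K \<subseteq> {0<..} \<times> UNIV"
    using K(2) by auto
  ultimately show ?thesis
    using cont \<open>M > 0\<close> by blast
qed

text \<open>Fubini exchanges the expectation with the integral over \<open>(t, x)\<close>, which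
  vanishes for every realisation. The integrand is bounded and supported in a set of finite product
  measure.\<close>

lemma expected_transport_adjoint_integral:
  fixes c :: "real \<Rightarrow> real ^ 'n"
  assumes \<mu>: "prob_space \<mu>"
    and c': "\<And>i x. ((\<lambda>x. c x $ i) has_real_derivative c' i x) (at x)"
      "\<And>i. continuous_on UNIV (c' i)"
    and u: "\<And>\<omega>. \<omega> \<in> space \<mu> \<Longrightarrow> solves_decoupled c (v0 \<omega>) (\<lambda>t x. u t x \<omega>)"
    and \<phi>: "pointwise_statistics \<mu> u \<phi>"
    and \<psi>: "test_function \<psi>"
  shows "has_bochner_integral lborel
    (\<lambda>p. \<integral>\<omega>. transport_adjoint c \<psi> (fst p) (snd p) (\<chi> i. u (fst p) (snd p $ i) \<omega> $ i) \<partial>\<mu>) 0"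
proof -
  interpret \<mu>: prob_space \<mu>
    by fact
  interpret pair_sigma_finite "lborel :: (real \<times> (real ^ 'n)) measure" \<mu> ..
  let ?g = "transport_adjoint c \<psi>"
  obtain J M where J: "compact J" "J \<subseteq> {0<..} \<times> UNIV"
    and J_off: "\<And>t x U. (t, x) \<notin> J \<Longrightarrow> ?g t x U = 0"
    and M: "0 < M" "\<And>t x U. \<bar>?g t x U\<bar> \<le> M"
    and cont: "continuous_on UNIV (\<lambda>(t, x, U). ?g t x U)"
    using transport_adjoint_compact_support[OF c' \<psi>] by blast
  have J_pos: "t > 0" if "(t, x) \<in> J" for t x
    using that J(2) by auto
  define F where "F p \<omega> = transport_adjoint c \<psi> (fst p) (snd p) (\<chi> i. u (fst p) (snd p $ i) \<omega> $ i)" for p \<omega>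
  have cont_u: "continuous_on ({0..} \<times> UNIV) (\<lambda>(t, x). u t x \<omega>)" if "\<omega> \<in> space \<mu>" for \<omega>
    using u[OF that] unfolding solves_decoupled_def regular_field_def by blast
  \<comment> \<open>Clamping changes nothing: at nonpositive times, hence off \<open>J\<close>, the
    value is \<open>0\<close> whatever the last argument.\<close>
  have F_clamp: "F p \<omega> = transport_adjoint c \<psi> (fst p) (snd p) (\<chi> i. u (max 0 (fst p)) (snd p $ i) \<omega> $ i)" for p \<omega>
  proof (cases "p \<in> J")
    case True
    then have "fst p > 0"
      using J_pos[of "fst p" "snd p"] by simp
    then show ?thesis
      by (simp add: F_def)
  next
    case False
    then show ?thesis
      using J_off[of "fst p" "snd p"] by (simp add: F_def)
  qed
  have F_meas: "case_prod F \<in> borel_measurable (lborel \<Otimes>\<^sub>M \<mu>)"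
  proof -
    have V: "(\<lambda>p. \<chi> i. u (max 0 (fst (fst p))) (snd (fst p) $ i) (snd p) $ i)
      \<in> borel_measurable ((borel \<Otimes>\<^sub>M borel) \<Otimes>\<^sub>M \<mu>)"
      by (rule observation_measurable[OF \<phi> cont_u])
    have g: "(\<lambda>(t, x, U). transport_adjoint c \<psi> t x U) \<in> borel_measurable (borel \<Otimes>\<^sub>M borel \<Otimes>\<^sub>M borel)"
      using borel_measurable_continuous_onI[OF cont] by (simp only: borel_prod)
    have arg: "(\<lambda>p. (fst (fst p), snd (fst p), \<chi> i. u (max 0 (fst (fst p))) (snd (fst p) $ i) (snd p) $ i))
      \<in> (borel \<Otimes>\<^sub>M borel) \<Otimes>\<^sub>M \<mu> \<rightarrow>\<^sub>M borel \<Otimes>\<^sub>M borel \<Otimes>\<^sub>M borel"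
      using V by measurable
    note measurable_compose[OF arg g, unfolded prod.case]
    moreover have "sets ((borel \<Otimes>\<^sub>M borel) \<Otimes>\<^sub>M \<mu>) = sets ((lborel :: (real \<times> (real ^ 'n)) measure) \<Otimes>\<^sub>M \<mu>)"
      by (intro sets_pair_measure_cong) (simp_all only: sets_lborel borel_prod)
    ultimately show ?thesis
      by (simp add: F_clamp case_prod_unfold cong: measurable_cong_sets)
  qed
  have J_sets: "J \<in> sets lborel"
    using borel_compact[OF J(1)] by simp
  have F_int: "integrable (lborel \<Otimes>\<^sub>M \<mu>) (case_prod F)"
  proof (rule integrableI_bounded_set[where A = "J \<times> space \<mu>" and B = M])
    show "J \<times> space \<mu> \<in> sets (lborel \<Otimes>\<^sub>M \<mu>)"
      using J_sets by (intro pair_measureI) auto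
    show "emeasure (lborel \<Otimes>\<^sub>M \<mu>) (J \<times> space \<mu>) < \<infinity>"
      using emeasure_compact_finite[OF J(1)] J_sets
      by (subst \<mu>.emeasure_pair_measure_Times) (auto simp: \<mu>.emeasure_space_1)
    have "case_prod F p = 0" if "p \<in> space (lborel \<Otimes>\<^sub>M \<mu>) - J \<times> space \<mu>" for p
      using that J_off[of "fst (fst p)" "snd (fst p)"]
      by (auto simp: F_def space_pair_measure case_prod_unfold mem_Times_iff)
    then show "AE p in lborel \<Otimes>\<^sub>M \<mu>. p \<notin> J \<times> space \<mu> \<longrightarrow> case_prod F p = 0"
      by (intro AE_I2) blast
  qed (use F_meas M(2) in \<open>auto simp: F_def\<close>)
  have "has_bochner_integral lborel (\<lambda>p. F p \<omega>) 0" if "\<omega> \<in> space \<mu>" for \<omega>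
    using transport_adjoint_integral_zero[OF u[OF that] c' \<psi>] by (simp add: F_def case_prod_unfold)
  then have "(\<integral>\<omega>. (\<integral>p. F p \<omega> \<partial>lborel) \<partial>\<mu>) = (\<integral>\<omega>. 0 \<partial>\<mu>)"
    by (intro Bochner_Integration.integral_cong) (auto simp: has_bochner_integral_iff)
  then have "(\<integral>p. (\<integral>\<omega>. F p \<omega> \<partial>\<mu>) \<partial>lborel) = 0"
    using Fubini_integral[OF F_int] by simp
  with integrable_fst[OF F_int] show ?thesis
    by (simp add: has_bochner_integral_iff F_def)
qed

text \<open>Integrating out \<open>U\<close> first replaces \<open>f\<close> by an expectation. This
  is legitimate because the integrand is bounded by \<open>M\<close> times \<open>f\<close> over
  \<open>J\<close> and \<open>f\<close> has mass \<open>1\<close> in \<open>U\<close>, so the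
  integral of its absolute value is at most \<open>M\<close> times the measure of
  \<open>J\<close>.\<close>

lemma transport_distributional_density:
  fixes c :: "real \<Rightarrow> real ^ 'n"
  assumes \<mu>: "prob_space \<mu>"
    and c': "\<And>i x. ((\<lambda>x. c x $ i) has_real_derivative c' i x) (at x)"
      "\<And>i. continuous_on UNIV (c' i)"
    and u: "\<And>\<omega>. \<omega> \<in> space \<mu> \<Longrightarrow> solves_decoupled c (v0 \<omega>) (\<lambda>t x. u t x \<omega>)"
    and \<phi>: "pointwise_statistics \<mu> u \<phi>"
    and f: "is_density \<phi> f"
  shows "transport_distributional c f"
  unfolding transport_distributional_def transport_adjoint_def[symmetric]
proof (intro allI impI)
  fix \<psi> :: "real \<Rightarrow> real ^ 'n \<Rightarrow> real ^ 'n \<Rightarrow> real"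
  assume \<psi>: "test_function \<psi>"
  let ?g = "transport_adjoint c \<psi>"
  obtain J M where J: "compact J" "J \<subseteq> {0<..} \<times> UNIV"
    and J_off: "\<And>t x U. (t, x) \<notin> J \<Longrightarrow> ?g t x U = 0"
    and M: "0 < M" "\<And>t x U. \<bar>?g t x U\<bar> \<le> M"
    and cont: "continuous_on UNIV (\<lambda>(t, x, U). ?g t x U)"
    using transport_adjoint_compact_support[OF c' \<psi>] by blast
  have J_pos: "t > 0" if "(t, x) \<in> J" for t x
    using that J(2) by auto
  define F where "F z = f (fst z) (fst (snd z)) (snd (snd z)) * ?g (fst z) (fst (snd z)) (snd (snd z))" for z
  have g_meas: "(\<lambda>z. ?g (fst z) (fst (snd z)) (snd (snd z))) \<in> borel_measurable borel"
    using borel_measurable_continuous_onI[OF cont] by (simp add: case_prod_unfold)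
  have F_meas: "F \<in> borel_measurable borel"
  proof -
    \<comment> \<open>\<open>is_density\<close> gives measurability only for
      \<open>t \<ge> 0\<close>; the cut-off is harmless since the other factor vanishes unless
      \<open>t > 0\<close>.\<close>
    have "(\<lambda>z. indicator ({0..} \<times> UNIV) z *\<^sub>R f (fst z) (fst (snd z)) (snd (snd z))) \<in> borel_measurable borel"
      using f unfolding is_density_def
      by (subst (asm) borel_measurable_restrict_space_iff) (auto simp: case_prod_unfold intro!: borel_closed closed_Times)
    from borel_measurable_times[OF this g_meas]
    have "(\<lambda>z. indicator ({0..} \<times> UNIV) z *\<^sub>R f (fst z) (fst (snd z)) (snd (snd z)) *
        ?g (fst z) (fst (snd z)) (snd (snd z))) \<in> borel_measurable borel" .
    moreover have "indicator ({0..} \<times> UNIV) z *\<^sub>R f (fst z) (fst (snd z)) (snd (snd z)) *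
        ?g (fst z) (fst (snd z)) (snd (snd z)) = F z" for z
      using J_pos J_off[of "fst z" "fst (snd z)" "snd (snd z)"]
      by (cases "fst z > 0") (auto simp: F_def indicator_def mem_Times_iff)
    ultimately show ?thesis
      by simp
  qed
  have f_nonneg: "0 \<le> f t x U" if "t \<ge> 0" for t x U
    using f that unfolding is_density_def by blast
  have inner: "(\<integral>\<^sup>+ U. ennreal (norm (F (t, x, U))) \<partial>lborel) \<le> ennreal M * indicator J (t, x)" for t x
  proof (cases "(t, x) \<in> J")
    case True
    then have t: "t \<ge> 0"
      using J_pos by force
    have [measurable]: "f t x \<in> borel_measurable borel"
      by (rule is_density_measurable[OF f t])
    have "(\<integral>\<^sup>+ U. ennreal (norm (F (t, x, U))) \<partial>lborel) \<le> (\<integral>\<^sup>+ U. ennreal M * ennreal (f t x U) \<partial>lborel)"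
    proof (rule nn_integral_mono)
      fix U
      have "norm (F (t, x, U)) \<le> M * f t x U"
        using mult_left_mono[OF M(2)[of t x U] f_nonneg[OF t, of x U]] f_nonneg[OF t, of x U]
        by (simp add: F_def abs_mult mult.commute)
      then show "ennreal (norm (F (t, x, U))) \<le> ennreal M * ennreal (f t x U)"
        using f_nonneg[OF t, of x U] M(1) by (simp add: ennreal_mult[symmetric] ennreal_leI)
    qed
    also have "\<dots> = ennreal M"
      using density_nn_integral[OF \<phi> f t, of x] by (simp add: nn_integral_cmult)
    finally show ?thesis
      using True by simp
  next
    case False
    then show ?thesis
      by (simp add: F_def J_off)
  qed
  have J_sets: "J \<in> sets borel"
    by (rule borel_compact[OF J(1)])
  have "(\<integral>\<^sup>+ z. ennreal (norm (F z)) \<partial>lborel)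
      = (\<integral>\<^sup>+ t. \<integral>\<^sup>+ x. \<integral>\<^sup>+ U. ennreal (norm (F (t, x, U))) \<partial>lborel \<partial>lborel \<partial>lborel)"
  proof -
    have 1: "(\<lambda>z. ennreal (norm (F z))) \<in> borel_measurable (lborel \<Otimes>\<^sub>M lborel)"
      using F_meas by (simp add: lborel_prod)
    have 2: "(\<lambda>y. ennreal (norm (F (t, y)))) \<in> borel_measurable (lborel \<Otimes>\<^sub>M lborel)" for t
      using measurable_compose_Pair1[OF _ 1, of t] by (simp add: lborel_prod)
    show ?thesis
      using lborel.nn_integral_fst[OF 1] lborel.nn_integral_fst[OF 2] by (simp add: lborel_prod)
  qed
  also have "\<dots> \<le> (\<integral>\<^sup>+ t. \<integral>\<^sup>+ x. ennreal M * indicator J (t, x) \<partial>lborel \<partial>lborel)"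
    by (intro nn_integral_mono inner)
  also have "\<dots> = (\<integral>\<^sup>+ p. ennreal M * indicator J p \<partial>lborel)"
  proof -
    have "(\<lambda>p. ennreal M * indicator J p) \<in> borel_measurable (lborel \<Otimes>\<^sub>M lborel)"
      using J_sets by (simp add: lborel_prod)
    from lborel.nn_integral_fst[OF this] show ?thesis
      by (simp add: lborel_prod)
  qed
  also have "\<dots> = ennreal M * emeasure lborel J"
    using J_sets by (subst nn_integral_cmult) auto
  also have "\<dots> < \<infinity>"
    using emeasure_compact_finite[OF J(1)] by (simp add: ennreal_mult_less_top)
  finally have F_int: "integrable lborel F"
    using F_meas by (intro integrableI_bounded) auto
  define E where "E p = (\<integral>\<omega>. ?g (fst p) (snd p) (\<chi> i. u (fst p) (snd p $ i) \<omega> $ i) \<partial>\<mu>)" for p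
  have E: "integrable lborel E" "(\<integral>p. E p \<partial>lborel) = 0"
    using expected_transport_adjoint_integral[OF \<mu> c' u \<phi> \<psi>]
    by (simp_all add: has_bochner_integral_iff E_def[abs_def])
  have F_E: "(\<integral>U. F (t, x, U) \<partial>lborel) = E (t, x)" for t x
  proof (cases "(t, x) \<in> J")
    case True
    then have t: "t \<ge> 0"
      using J_pos by force
    have "(\<lambda>U. (t, x, U)) \<in> borel \<rightarrow>\<^sub>M borel"
      by (intro borel_measurable_continuous_onI continuous_intros)
    from measurable_compose[OF this g_meas] have "?g t x \<in> borel_measurable borel"
      by simp
    from density_expectation[OF \<mu> \<phi> f t this] show ?thesis
      by (simp add: F_def E_def)
  next
    case False
    then show ?thesis
      by (simp add: F_def E_def J_off)
  qed
  have F_int': "integrable (lborel \<Otimes>\<^sub>M lborel) F"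
    using F_int by (simp add: lborel_prod)
  have "(\<integral>z. F z \<partial>lborel) = (\<integral>t. (\<integral>y. F (t, y) \<partial>lborel) \<partial>lborel)"
    using lborel_pair.integral_fst'[OF F_int'] by (simp add: lborel_prod)
  \<comment> \<open>Triples are nested as \<open>(t, (x, U))\<close>, so \<open>U\<close> is not
    split off directly: for almost every \<open>t\<close> the slice in \<open>(x, U)\<close> is
    integrable, and Fubini is applied once more to it.\<close>
  also have "\<dots> = (\<integral>t. (\<integral>x. E (t, x) \<partial>lborel) \<partial>lborel)"
  proof (rule integral_cong_AE)
    have "AE t in lborel. integrable lborel (\<lambda>y. F (t, y))"
      using lborel_pair.AE_integrable_fst'[OF F_int'] .
    then show "AE t in lborel. (\<integral>y. F (t, y) \<partial>lborel) = (\<integral>x. E (t, x) \<partial>lborel)"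
    proof eventually_elim
      case (elim t)
      then have "integrable (lborel \<Otimes>\<^sub>M lborel) (\<lambda>y. F (t, y))"
        by (simp add: lborel_prod)
      from lborel_pair.integral_fst'[OF this] show ?case
        by (simp add: lborel_prod F_E)
    qed
    show "(\<lambda>t. \<integral>y. F (t, y) \<partial>lborel) \<in> borel_measurable lborel"
      using lborel_pair.integrable_fst'[OF F_int'] by (rule borel_measurable_integrable)
    have "integrable (lborel \<Otimes>\<^sub>M lborel) E"
      using E(1) by (simp add: lborel_prod)
    from lborel_pair.integrable_fst'[OF this]
    show "(\<lambda>t. \<integral>x. E (t, x) \<partial>lborel) \<in> borel_measurable lborel"
      by (rule borel_measurable_integrable)
  qed
  also have "\<dots> = 0"
  proof -
    have "integrable (lborel \<Otimes>\<^sub>M lborel) E"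
      using E(1) by (simp add: lborel_prod)
    from lborel_pair.integral_fst'[OF this] E(2) show ?thesis
      by (simp add: lborel_prod)
  qed
  finally have "has_bochner_integral lborel F 0"
    using F_int by (simp add: has_bochner_integral_iff)
  then show "has_bochner_integral lborel (\<lambda>(t, x, U). f t x U * ?g t x U) 0"
    by (simp add: F_def[abs_def] case_prod_unfold)
qed

section \<open>From the matrix system to the density\<close>

text \<open>Each coefficient is a fixed linear functional of \<open>D x\<close>, a diagonal entry of
  \<open>P ** D x ** Q\<close>, so it inherits derivatives from \<open>D\<close>. Continuity of the
  first derivative comes from the existence of the second.\<close>

lemma smooth_curve_diagonal_entries:
  fixes D :: "real \<Rightarrow> real ^ 'n ^ 'n"
  assumes D: "smooth_curve D" and PDQ: "\<And>x. P ** D x ** Q = diag_matrix (c x)"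
  shows "\<exists>c'. (\<forall>i x. ((\<lambda>x. c x $ i) has_real_derivative c' i x) (at x)) \<and>
    (\<forall>i. continuous_on UNIV (c' i))"
proof -
  obtain G where G: "G 0 = D" "\<And>k x. (G k has_vector_derivative G (Suc k) x) (at x)"
    using D unfolding smooth_curve_def by blast
  define L where "L i A = (P ** A ** Q) $ i $ i" for i and A :: "real ^ 'n ^ 'n"
  have c: "c x $ i = L i (G 0 x)" for i x
    by (simp add: L_def G(1) PDQ diag_matrix_def)
  have L: "bounded_linear (L i)" for i
    by (intro linear_conv_bounded_linear[THEN iffD1] linearI)
      (simp_all add: L_def matrix_matrix_mult_def algebra_simps sum.distrib sum_distrib_left)
  have "((\<lambda>x. c x $ i) has_real_derivative L i (G 1 x)) (at x)" for i x
    unfolding c has_real_derivative_iff_has_vector_derivative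
    using bounded_linear.has_vector_derivative[OF L G(2)[of 0 x]] by simp
  moreover have "continuous_on UNIV (G 1)"
    using G(2) by (intro continuous_at_imp_continuous_on ballI has_vector_derivative_continuous) blast
  then have "continuous_on UNIV (\<lambda>x. L i (G 1 x))" for i
    by (rule bounded_linear.continuous_on[OF L])
  ultimately show ?thesis
    by (intro exI[of _ "\<lambda>i x. L i (G 1 x)"]) blast
qed

text \<open>A density may be altered on null sets of \<open>U\<close> that vary with
  \<open>(t, x)\<close>, which can destroy differentiability. For an arbitrary version the equation
  is therefore asserted in the sense of distributions and, where \<open>f\<close> is differentiable
  in \<open>(t, x)\<close>, for almost every \<open>U\<close>; continuity in \<open>U\<close>
  excludes such alterations and gives it for every \<open>U\<close>.\<close>

theorem proposition4p5:
  fixes \<Omega> :: "(real ^ 'd) set"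
    and \<mu> :: "(real ^ 'd) measure"
    and D :: "real \<Rightarrow> real ^ 'n ^ 'n"
    and P :: "real ^ 'n ^ 'n"
    and c :: "real \<Rightarrow> real ^ 'n"
    and z0 :: "real \<Rightarrow> real ^ 'd \<Rightarrow> real ^ 'n"
    and z u :: "real \<Rightarrow> real \<Rightarrow> real ^ 'd \<Rightarrow> real ^ 'n"
    and \<phi> :: "real \<Rightarrow> real ^ 'n \<Rightarrow> (real ^ 'n) measure"
    and f :: "real \<Rightarrow> real ^ 'n \<Rightarrow> real ^ 'n \<Rightarrow> real"
  assumes N: "CARD('n) > 1"
    and borel: "sets \<mu> = sets (restrict_space borel \<Omega>)"
    and prob: "prob_space \<mu>"
    and D_smooth: "smooth_curve D"
    and D_diagonalizable: "\<And>x. real_diagonalizable (D x)"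
    and P: "invertible P"
    and PDP: "\<And>x. P ** D x ** matrix_inv P = diag_matrix (c x)"
    and z0: "\<And>x. z0 x \<in> borel_measurable \<mu>"
    and z: "\<And>\<omega>. \<omega> \<in> \<Omega> \<Longrightarrow> solves_system D (\<lambda>x. z0 x \<omega>) (\<lambda>t x. z t x \<omega>)"
    and u: "\<And>t x \<omega>. u t x \<omega> = P *v z t x \<omega>"
    and \<phi>: "pointwise_statistics \<mu> u \<phi>"
    and f: "is_density \<phi> f"
  shows "(\<forall>w0 w. solves_system D w0 w \<longleftrightarrow>
            solves_decoupled c (\<lambda>x. P *v w0 x) (\<lambda>t x. P *v w t x))
       \<and> transport_distributional c f
       \<and> (\<forall>t>0. \<forall>x. AE U in lborel.
            (\<lambda>(s, y). f s y U) differentiable (at (t, x)) \<longrightarrow> transport_operator c f t x U = 0)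
       \<and> ((\<forall>t>0. \<forall>x. continuous_on UNIV (f t x)) \<longrightarrow>
            (\<forall>t>0. \<forall>x U.
               (\<lambda>(s, y). f s y U) differentiable (at (t, x)) \<longrightarrow> transport_operator c f t x U = 0))"
proof -
  have space: "space \<mu> = \<Omega>"
    using sets_eq_imp_space_eq[OF borel] by (simp add: space_restrict_space)
  obtain c' where c': "\<And>i x. ((\<lambda>x. c x $ i) has_real_derivative c' i x) (at x)"
      "\<And>i. continuous_on UNIV (c' i)"
    using smooth_curve_diagonal_entries[OF D_smooth PDP] by blast
  have c: "continuous_on UNIV (\<lambda>x. c x $ i)" for i
    using c'(1) by (intro continuous_at_imp_continuous_on ballI DERIV_isCont) blast
  have iff: "solves_system D w0 w \<longleftrightarrow> solves_decoupled c (\<lambda>x. P *v w0 x) (\<lambda>t x. P *v w t x)" for w0 w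
    by (rule solves_system_iff_decoupled[OF P PDP])
  \<comment> \<open>The equivalence read for a single realisation; \<open>\<Omega>\<close> is the
    whole sample space of \<open>\<mu>\<close>.\<close>
  have dec: "solves_decoupled c (\<lambda>x. P *v z0 x \<omega>) (\<lambda>t x. u t x \<omega>)" if "\<omega> \<in> space \<mu>" for \<omega>
    unfolding u iff[symmetric] using z that by (simp only: space)
  have "transport_distributional c f"
    by (rule transport_distributional_density[OF prob c' dec \<phi> f])
  moreover have "AE U in lborel. (\<lambda>(s, y). f s y U) differentiable (at (t, x)) \<longrightarrow> transport_operator c f t x U = 0"
    if "t > 0" for t x
    by (rule AE_transport_zero[OF c dec \<phi> f that])
  moreover have "transport_operator c f t x U = 0"
    if "\<forall>t>0. \<forall>x. continuous_on UNIV (f t x)" "t > 0" "(\<lambda>(s, y). f s y U) differentiable (at (t, x))"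
    for t x U
    by (rule continuous_transport_zero[OF c dec \<phi> f that(1)[rule_format] that(2,3)])
  ultimately show ?thesis
    using iff by blast
qed

end
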